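(* Let $p$ be a prime and let $G = G_p(\alpha,\beta,\epsilon,\delta,+)$ be a metacyclic $p$-group of positive type. (i) If $\delta\ge\epsilon$, or if $\delta<\epsilon$ and $\alpha\ge\beta+\epsilon$, then $\eta(G)=g_p(\alpha-\delta,\beta)$. Explicitly: (a) if $\beta\le\alpha-\delta$, then $\eta(G)=p^{\beta-1}\big((\alpha-\delta-\beta)(p-1)+p+1\big)$; (b) if $\beta>\alpha-\delta$, then $\eta(G)=p^{\alpha-\delta-1}\big((\beta-\alpha+\delta)(p-1)+p+1\big)$. (ii) If $\delta<\epsilon$ and $\alpha<\beta+\epsilon$, then $\eta(G)=g_p(\alpha-\epsilon,\beta+\epsilon-\delta)=p^{\alpha-\epsilon-1}\big((\beta-\alpha+2\epsilon-\delta)(p-1)+p+1\big)$.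
   Context: For a finite group $G$, a maximal cyclic subgroup is a cyclic subgroup not properly contained in any other cyclic subgroup, and $\eta(G)$ is the number of conjugacy classes of maximal cyclic subgroups of $G$. Write $x^y = y^{-1}xy$. For a prime $p$ and integers $\alpha,\beta>0$, $\delta,\epsilon\ge 0$ with $\delta\le\min\{\alpha-1,\beta\}$, $\delta+\epsilon\le\alpha$, and, if $p=2$, also $\alpha-\delta>1$, the metacyclic group of positive type is $$G_p(\alpha,\beta,\epsilon,\delta,+)=\langle x,y \mid x^{p^\alpha}=1,\ y^{p^\beta}=x^{p^{\alpha-\epsilon}},\ x^y=x^{r}\rangle,\quad r=p^{\alpha-\delta}+1.$$ It has order $p^{\alpha+\beta}$. For positive integers $a,b$, with $k=\max(a,b)$ and $l=\min(a,b)$, set $g_p(a,b)=p^{l-1}\big((k-l)(p-1)+p+1\big)$.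
   Formalization: Part (ii) is proved under the extra condition α > ε: if ε = α then δ = 0 and G is cyclic, so η(G) = 1, while g_p(0, α+β) is undefined and the explicit formula gives a value greater than 1. *)

theory Defs
  imports "HOL-Algebra.Elementary_Groups" "HOL-Computational_Algebra.Primes"
begin

section \<open>Groups given by generators and relations\<close>

datatype 'g letter = Pos 'g | Neg 'g

type_synonym 'g word = "'g letter list"

text \<open>
  The least congruence on words that makes \<open>Neg a\<close> a two-sided inverse of \<open>Pos a\<close> and
  identifies both sides of every relation. A relation \<open>u = v\<close> is given as the pair \<open>(u, v)\<close>.
\<close>

inductive word_eq :: "('g word \<times> 'g word) set \<Rightarrow> 'g word \<Rightarrow> 'g word \<Rightarrow> bool"
  for R :: "('g word \<times> 'g word) set"
where
  refl: "word_eq R u u"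
| sym: "word_eq R u v \<Longrightarrow> word_eq R v u"
| trans: "word_eq R u v \<Longrightarrow> word_eq R v w \<Longrightarrow> word_eq R u w"
| append: "word_eq R u u' \<Longrightarrow> word_eq R v v' \<Longrightarrow> word_eq R (u @ v) (u' @ v')"
| inv_right: "word_eq R [Pos a, Neg a] []"
| inv_left: "word_eq R [Neg a, Pos a] []"
| relation: "(u, v) \<in> R \<Longrightarrow> word_eq R u v"

definition word_class :: "('g word \<times> 'g word) set \<Rightarrow> 'g word \<Rightarrow> 'g word set" where
  "word_class R u = {v. word_eq R u v}"

definition presented_group :: "('g word \<times> 'g word) set \<Rightarrow> 'g word set monoid" where
  "presented_group R =
     \<lparr>carrier = range (word_class R),
      monoid.mult = (\<lambda>A B. \<Union>u\<in>A. \<Union>v\<in>B. word_class R (u @ v)),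
      monoid.one = word_class R []\<rparr>"

lemma word_class_eq_iff: "word_class R u = word_class R v \<longleftrightarrow> word_eq R u v"
proof
  assume "word_class R u = word_class R v"
  moreover have "v \<in> word_class R v"
    by (simp add: word_class_def word_eq.refl)
  ultimately show "word_eq R u v"
    by (simp add: word_class_def set_eq_iff)
next
  assume uv: "word_eq R u v"
  have "word_eq R u w \<longleftrightarrow> word_eq R v w" for w
    using word_eq.trans[OF uv] word_eq.trans[OF word_eq.sym[OF uv]] by iprover
  then show "word_class R u = word_class R v"
    by (simp add: word_class_def)
qed

lemma presented_group_mult:
  "word_class R u \<otimes>\<^bsub>presented_group R\<^esub> word_class R v = word_class R (u @ v)"
proof -
  have *: "word_class R (u' @ v') = word_class R (u @ v)"
    if "u' \<in> word_class R u" "v' \<in> word_class R v" for u' v'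
    unfolding word_class_eq_iff
    using that by (simp add: word_class_def word_eq.append word_eq.sym)
  have "u \<in> word_class R u" "v \<in> word_class R v"
    by (simp_all add: word_class_def word_eq.refl)
  then have "(\<Union>u'\<in>word_class R u. \<Union>v'\<in>word_class R v. word_class R (u' @ v')) = word_class R (u @ v)"
    using * by blast
  then show ?thesis
    by (simp add: presented_group_def)
qed

lemma word_eq_left_inverse: "\<exists>v. word_eq R (v @ u) []"
proof (induction u)
  case Nil
  show ?case by (auto intro: word_eq.refl)
next
  case (Cons l u)
  then obtain v where v: "word_eq R (v @ u) []" by blast
  obtain l' where l': "word_eq R [l', l] []"
    by (cases l) (auto intro: word_eq.inv_left word_eq.inv_right)
  have "word_eq R ([l', l] @ u) ([] @ u)"
    by (rule word_eq.append[OF l' word_eq.refl])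
  then have "word_eq R (v @ ([l', l] @ u)) (v @ ([] @ u))"
    by (rule word_eq.append[OF word_eq.refl])
  then have "word_eq R ((v @ [l']) @ l # u) []"
    using word_eq.trans[OF _ v] by simp
  then show ?case by blast
qed

lemma carrier_presented_group: "carrier (presented_group R) = range (word_class R)"
  by (simp add: presented_group_def)

lemma one_presented_group: "\<one>\<^bsub>presented_group R\<^esub> = word_class R []"
  by (simp add: presented_group_def)

lemma group_presented_group: "group (presented_group R)"
proof (rule groupI)
  fix A assume "A \<in> carrier (presented_group R)"
  then obtain u where u: "A = word_class R u" by (auto simp: carrier_presented_group)
  obtain v where "word_eq R (v @ u) []" using word_eq_left_inverse by blast
  then have "word_class R v \<otimes>\<^bsub>presented_group R\<^esub> A = word_class R []"
    unfolding u presented_group_mult word_class_eq_iff .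
  then show "\<exists>B\<in>carrier (presented_group R). B \<otimes>\<^bsub>presented_group R\<^esub> A = \<one>\<^bsub>presented_group R\<^esub>"
    by (auto simp: carrier_presented_group one_presented_group)
qed (auto simp: carrier_presented_group one_presented_group presented_group_mult)

section \<open>Metacyclic groups of positive type\<close>

datatype metacyclic_gen = gen_x | gen_y

definition metacyclic_positive :: "nat \<Rightarrow> nat \<Rightarrow> nat \<Rightarrow> nat \<Rightarrow> nat \<Rightarrow> metacyclic_gen word set monoid" where
  "metacyclic_positive p \<alpha> \<beta> \<epsilon> \<delta> = presented_group
     {(replicate (p ^ \<alpha>) (Pos gen_x), []),
      (replicate (p ^ \<beta>) (Pos gen_y), replicate (p ^ (\<alpha> - \<epsilon>)) (Pos gen_x)),
      ([Neg gen_y, Pos gen_x, Pos gen_y], replicate (p ^ (\<alpha> - \<delta>) + 1) (Pos gen_x))}"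

definition positive_type_params :: "nat \<Rightarrow> nat \<Rightarrow> nat \<Rightarrow> nat \<Rightarrow> nat \<Rightarrow> bool" where
  "positive_type_params p \<alpha> \<beta> \<epsilon> \<delta> \<longleftrightarrow>
     \<alpha> > 0 \<and> \<beta> > 0 \<and> \<delta> \<le> min (\<alpha> - 1) \<beta> \<and> \<delta> + \<epsilon> \<le> \<alpha> \<and> (p = 2 \<longrightarrow> \<alpha> - \<delta> > 1)"

section \<open>Conjugacy classes of maximal cyclic subgroups\<close>

definition cyclic_subgroup :: "('a, 'b) monoid_scheme \<Rightarrow> 'a set \<Rightarrow> bool" where
  "cyclic_subgroup G C \<longleftrightarrow> subgroup C G \<and> cyclic_group (subgroup_generated G C)"

definition maximal_cyclic_subgroup :: "('a, 'b) monoid_scheme \<Rightarrow> 'a set \<Rightarrow> bool" where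
  "maximal_cyclic_subgroup G C \<longleftrightarrow>
     cyclic_subgroup G C \<and> \<not> (\<exists>D. cyclic_subgroup G D \<and> C \<subset> D)"

definition conjugacy_rel :: "('a, 'b) monoid_scheme \<Rightarrow> ('a set \<times> 'a set) set" where
  "conjugacy_rel G =
     {(C, D). \<exists>g\<in>carrier G. D = (\<lambda>x. inv\<^bsub>G\<^esub> g \<otimes>\<^bsub>G\<^esub> x \<otimes>\<^bsub>G\<^esub> g) ` C}"

definition eta :: "('a, 'b) monoid_scheme \<Rightarrow> nat" where
  "eta G = card ({C. maximal_cyclic_subgroup G C} // conjugacy_rel G)"

text \<open>Only meaningful for \<open>a, b > 0\<close>: otherwise the exponent below is truncated.\<close>

definition g_fun :: "nat \<Rightarrow> nat \<Rightarrow> nat \<Rightarrow> nat" where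
  "g_fun p a b =
     (let k = max a b; l = min a b in p ^ (l - 1) * ((k - l) * (p - 1) + p + 1))"

end

theory Submission
  imports Defs "HOL-Number_Theory.Cong" "HOL-Number_Theory.Totient"
begin

text \<open>
  Put \<open>n = \<alpha> - \<delta>\<close> and \<open>r = p ^ n + 1\<close>. The theorem holds because \<open>\<eta>(G)\<close> equals
  \<open>\<eta>(G / G')\<close>, where \<open>G' = \<langle>x ^ (p ^ n)\<rangle>\<close> is the commutator subgroup, and \<open>G / G'\<close> is a product
  of two cyclic groups, for which \<open>\<eta>\<close> can be counted by hand.

  Every element is \<open>y ^ j x ^ i\<close>. Call it primitive if \<open>p\<close> does not divide both \<open>i\<close> and \<open>j\<close>; the
  other elements form the Frattini subgroup. Since \<open>r\<close> is congruent to \<open>1\<close> modulo \<open>p\<close> (modulo \<open>4\<close> if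
  \<open>p = 2\<close>), two things happen. An element that is not primitive is a \<open>p\<close>-th power
  (\<open>el_multiple_is_power\<close>), because \<open>1 + s + \<dots> + s ^ (p - 1)\<close> is \<open>p\<close> times a unit for every power
  \<open>s\<close> of \<open>r\<close>; hence the maximal cyclic subgroups are exactly those generated by primitive elements
  (\<open>maximal_cyclic_subgroup_iff\<close>). And the conjugacy class of a primitive element is a whole coset of
  \<open>G'\<close> (\<open>el_conjugate\<close>): conjugation by powers of \<open>y\<close> multiplies \<open>i\<close> by powers of \<open>r\<close>, which exhaust
  the residues congruent to \<open>1\<close> modulo \<open>p ^ n\<close>, and conjugation by powers of \<open>x\<close> adds multiples of
  \<open>r ^ j - 1\<close> to \<open>i\<close>, which is \<open>p ^ n\<close> times a unit when \<open>p\<close> does not divide \<open>j\<close>.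

  Two maximal cyclic subgroups are therefore conjugate if and only if the images of their generators
  in \<open>G / G'\<close> are unit multiples of each other (\<open>conjugate_powers_iff\<close>). If \<open>G / G'\<close> is the product
  of the integers modulo \<open>p ^ a\<close> and modulo \<open>p ^ b\<close>, it remains to count the primitive pairs of
  residues up to unit multiples; there are \<open>g_fun p a b\<close> classes (\<open>primitive_pairs_transversal\<close>).

  The abelianization has the relations \<open>p ^ n x = 0\<close> and \<open>p ^ \<beta> y = p ^ (\<alpha> - \<epsilon>) x\<close>, written additively.
  If \<open>\<epsilon> \<le> \<delta>\<close>, or if \<open>\<beta> + \<epsilon> \<le> \<alpha>\<close>, replacing \<open>y\<close> by \<open>y - t x\<close> for a suitable \<open>t\<close> gives
  \<open>(a, b) = (\<alpha> - \<delta>, \<beta>)\<close>. Otherwise \<open>x\<close> is replaced by \<open>x - p ^ (\<beta> + \<epsilon> - \<alpha>) y\<close>, which gives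
  \<open>(a, b) = (\<alpha> - \<epsilon>, \<beta> + \<epsilon> - \<delta>)\<close>. The coordinates of \<open>G / G'\<close> are
  weighted exponent sums of words: the relations determine them modulo \<open>p ^ a\<close> and \<open>p ^ b\<close>, and they
  separate the cosets of \<open>G'\<close>.
\<close>

section \<open>Units congruent to one modulo a prime power\<close>

lemma prime_power_unit_inverse:
  fixes k :: int
  assumes "prime p" "\<not> int p dvd k"
  obtains l where "\<not> int p dvd l" "[k * l = 1] (mod int p ^ N)"
proof -
  have "coprime k (int p ^ Suc N)"
    using assms prime_imp_coprime[of "int p" k] by (simp add: coprime_commute)
  then obtain l where l: "[k * l = 1] (mod int p ^ Suc N)"
    using cong_solve_coprime_int by blast
  then have "[k * l = 1] (mod int p)"
    by (rule cong_dvd_modulus) simp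
  moreover have "\<not> [0 = (1::int)] (mod int p)"
    using assms(1) prime_gt_1_nat[OF assms(1)] by (simp add: cong_def)
  ultimately have "\<not> int p dvd l"
    by (meson cong_0_iff cong_sym cong_trans dvd_mult)
  moreover have "[k * l = 1] (mod int p ^ N)"
    using l by (rule cong_dvd_modulus) (simp add: le_imp_power_dvd)
  ultimately show thesis by (rule that)
qed

text \<open>
  The binomial expansion of \<open>(1 + (s - 1)) ^ i\<close>, cut off after the linear term.
\<close>

lemma power_cong_linear:
  fixes s m :: int
  assumes "m dvd s - 1"
  shows "[s ^ i = 1 + int i * (s - 1)] (mod m\<^sup>2)"
proof (induction i)
  case (Suc i)
  have "[s * s ^ i = s * (1 + int i * (s - 1))] (mod m\<^sup>2)"
    using Suc by (rule cong_scalar_left)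
  also have "s * (1 + int i * (s - 1)) = 1 + int (Suc i) * (s - 1) + int i * (s - 1)\<^sup>2"
    by (simp add: algebra_simps power2_eq_square)
  also have "[\<dots> = 1 + int (Suc i) * (s - 1)] (mod m\<^sup>2)"
    using assms by (simp add: cong_iff_dvd_diff dvd_power_same)
  finally show ?case by simp
qed simp

text \<open>
  After linearization the sum is \<open>p + (s - 1) p (p - 1) / 2\<close>. For odd \<open>p\<close> the correction contains \<open>p\<close>
  twice; for \<open>p = 2\<close> it equals \<open>s - 1\<close>, which is why divisibility by \<open>4\<close> is required there.
\<close>

lemma geometric_sum_cong_prime:
  fixes s :: int
  assumes "prime p" "int p dvd s - 1" "p = 2 \<longrightarrow> 4 dvd s - 1"
  shows "[(\<Sum>i<p. s ^ i) = int p] (mod (int p)\<^sup>2)"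
proof -
  have "[(\<Sum>i<p. s ^ i) = (\<Sum>i<p. 1 + int i * (s - 1))] (mod (int p)\<^sup>2)"
    by (intro cong_sum power_cong_linear assms)
  also have "(\<Sum>i<p. 1 + int i * (s - 1)) = int p + (\<Sum>i<p. int i) * (s - 1)"
    by (simp add: sum.distrib sum_distrib_right)
  also have "[\<dots> = int p] (mod (int p)\<^sup>2)"
  proof (cases "p = 2")
    case True
    then show ?thesis using assms by (simp add: cong_iff_dvd_diff numeral_2_eq_2)
  next
    case False
    then have "odd p" using assms(1) prime_odd_nat prime_ge_2_nat
      by (metis le_neq_implies_less)
    have "2 * (\<Sum>i<p. int i) = int p * (int p - 1)"
      by (induction p) (auto simp: algebra_simps)
    then have "int p dvd 2 * (\<Sum>i<p. int i)" by simp
    moreover have "coprime (int p) 2" using \<open>odd p\<close> by simp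
    ultimately have "int p dvd (\<Sum>i<p. int i)"
      by (simp add: coprime_dvd_mult_right_iff)
    with assms(2) show ?thesis
      by (simp add: cong_iff_dvd_diff power2_eq_square mult_dvd_mono)
  qed
  finally show ?thesis .
qed

lemma geometric_sum_prime_unit:
  fixes s :: int
  assumes "prime p" "int p dvd s - 1" "p = 2 \<longrightarrow> 4 dvd s - 1"
  obtains w where "(\<Sum>i<p. s ^ i) = int p * w" "\<not> int p dvd w"
proof -
  obtain z where "(\<Sum>i<p. s ^ i) - int p = (int p)\<^sup>2 * z"
    using geometric_sum_cong_prime[OF assms] by (auto simp: cong_iff_dvd_diff dvd_def)
  then have eq: "(\<Sum>i<p. s ^ i) = int p * (1 + int p * z)"
    by (simp add: algebra_simps power2_eq_square)
  have "\<not> int p dvd 1 + int p * z"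
    using assms(1) prime_gt_1_nat[OF assms(1)] by (simp add: dvd_add_left_iff)
  with eq show thesis by (rule that)
qed

text \<open>
  The factorization \<open>s ^ p - 1 = (s - 1) (1 + s + \<dots> + s ^ (p - 1))\<close> shows that raising to the \<open>p\<close>-th
  power increases the exact power of \<open>p\<close> in \<open>s - 1\<close> by one.
\<close>

lemma lift_p_power:
  assumes "prime p" "n > 0" "p = 2 \<longrightarrow> n > 1"
  obtains w where "(1 + int p ^ n) ^ (p ^ e) = 1 + int p ^ (n + e) * w" "\<not> int p dvd w"
proof -
  have "\<exists>w. (1 + int p ^ n) ^ (p ^ e) = 1 + int p ^ (n + e) * w \<and> \<not> int p dvd w"
  proof (induction e)
    case 0
    show ?case using prime_gt_1_nat[OF assms(1)] by (intro exI[of _ 1]) simp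
  next
    case (Suc e)
    then obtain w where w: "(1 + int p ^ n) ^ (p ^ e) = 1 + int p ^ (n + e) * w" "\<not> int p dvd w"
      by blast
    define s where "s = 1 + int p ^ (n + e) * w"
    have "int p ^ 1 dvd int p ^ (n + e)"
      using assms(2) by (intro le_imp_power_dvd) simp
    then have 1: "int p dvd s - 1" by (simp add: s_def)
    have "4 dvd s - 1" if "p = 2"
    proof -
      have "int 2 ^ 2 dvd int 2 ^ (n + e)"
        using assms(3) that by (intro le_imp_power_dvd) simp
      then show ?thesis using that by (simp add: s_def)
    qed
    then obtain z where z: "(\<Sum>i<p. s ^ i) = int p * z" "\<not> int p dvd z"
      using geometric_sum_prime_unit[OF assms(1) 1] by blast
    have "s ^ p - 1 = (s - 1) * (\<Sum>i<p. s ^ i)"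
      by (simp add: power_diff_1_eq)
    also have "\<dots> = int p ^ (n + Suc e) * (w * z)"
      unfolding z(1) by (simp add: s_def)
    finally have "s ^ p = 1 + int p ^ (n + Suc e) * (w * z)"
      by (simp add: algebra_simps)
    moreover have "(1 + int p ^ n) ^ (p ^ Suc e) = s ^ p"
      by (simp add: w(1)[folded s_def] power_mult mult.commute[of p])
    moreover have "\<not> int p dvd w * z"
      using w z assms(1) by (simp add: prime_dvd_mult_iff)
    ultimately show ?case by metis
  qed
  then show thesis using that by blast
qed

text \<open>
  Among the residues modulo any higher power of \<open>p\<close>, those congruent to \<open>1\<close> modulo \<open>p ^ n\<close> form
  a cyclic group generated by \<open>1 + p ^ n\<close>. The exponent
  is built by successive approximation: multiplying by a power of \<open>(1 + p ^ n) ^ (p ^ e)\<close>, which is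
  \<open>1 + p ^ (n + e) w\<close> with a unit \<open>w\<close>, corrects one more \<open>p\<close>-adic digit.
\<close>

lemma principal_unit_power:
  fixes s :: int
  assumes "prime p" "n > 0" "p = 2 \<longrightarrow> n > 1" "[s = 1] (mod int p ^ n)"
  shows "\<exists>k::nat. [(1 + int p ^ n) ^ k = s] (mod int p ^ (n + e))"
proof (induction e)
  case 0
  show ?case using assms(4) by (intro exI[of _ 0]) (simp add: cong_sym_eq)
next
  case (Suc e)
  let ?r = "1 + int p ^ n"
  let ?m = "int p ^ (n + e)"
  obtain k where "[?r ^ k = s] (mod ?m)" using Suc by blast
  then obtain d where d: "s = ?r ^ k + ?m * d"
    by (metis cong_iff_lin cong_sym_eq)
  obtain w where w: "?r ^ (p ^ e) = 1 + ?m * w" "\<not> int p dvd w"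
    using lift_p_power[OF assms(1-3)] by blast
  have p1: "int p dvd ?r - 1" using assms(2) by (simp add: dvd_power)
  have "\<not> int p dvd ?r ^ k * w"
  proof -
    have "\<not> int p dvd ?r"
      using assms(2) prime_gt_1_nat[OF assms(1)] by (simp add: dvd_power dvd_add_left_iff)
    then show ?thesis using w assms(1)
      by (metis prime_dvd_mult_iff prime_dvd_power prime_nat_int_transfer)
  qed
  then obtain l where l: "[?r ^ k * w * l = 1] (mod int p ^ 1)"
    using prime_power_unit_inverse[OF assms(1)] by metis
  define z where "z = nat (l * d mod int p)"
  have z: "[?r ^ k * w * int z = d] (mod int p)"
  proof -
    have "int z = l * d mod int p"
      using prime_gt_0_nat[OF assms(1)] by (simp add: z_def)
    then have "[?r ^ k * w * int z = ?r ^ k * w * (l * d)] (mod int p)"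
      by (intro cong_scalar_left) (simp add: cong_def)
    also have "[?r ^ k * w * l * d = 1 * d] (mod int p)"
      using l by (intro cong_scalar_right) simp
    then have "[?r ^ k * w * (l * d) = d] (mod int p)" by (simp add: mult.assoc)
    finally show ?thesis .
  qed
  have dv: "int p ^ (n + Suc e) dvd ?m\<^sup>2"
    using assms(2) by (simp add: power_mult[symmetric] le_imp_power_dvd flip: power_Suc)
  have "[(1 + ?m * w) ^ z = 1 + int z * (?m * w)] (mod ?m\<^sup>2)"
    using power_cong_linear[of ?m "1 + ?m * w" z] by simp
  then have "[?r ^ k * (1 + ?m * w) ^ z = ?r ^ k * (1 + int z * (?m * w))] (mod int p ^ (n + Suc e))"
    using dv by (intro cong_scalar_left) (rule cong_dvd_modulus)
  also have "?r ^ k * (1 + int z * (?m * w)) = ?r ^ k + ?m * (?r ^ k * w * int z)"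
    by (simp add: algebra_simps)
  also have "[\<dots> = ?r ^ k + ?m * d] (mod int p ^ (n + Suc e))"
  proof -
    have "?m * int p dvd ?m * (?r ^ k * w * int z - d)"
      using z by (simp add: cong_iff_dvd_diff)
    then show ?thesis
      by (simp add: cong_iff_dvd_diff algebra_simps)
  qed
  finally have "[?r ^ (k + p ^ e * z) = s] (mod int p ^ (n + Suc e))"
    by (simp add: power_add power_mult w d)
  then show ?case by blast
qed

lemma power_minus_one_unit:
  assumes "prime p" "n > 0" "\<not> p dvd j"
  obtains w where "(1 + int p ^ n) ^ j = 1 + int p ^ n * w" "\<not> int p dvd w"
proof -
  have "[(1 + int p ^ n) ^ j = 1 + int j * int p ^ n] (mod (int p ^ n)\<^sup>2)"
    using power_cong_linear[of "int p ^ n" "1 + int p ^ n" j] by simp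
  then obtain d where d: "(1 + int p ^ n) ^ j = 1 + int j * int p ^ n + (int p ^ n)\<^sup>2 * d"
    by (metis cong_iff_lin cong_sym_eq)
  have "\<not> int p dvd int j + int p ^ n * d"
    using assms by (simp add: dvd_add_left_iff dvd_power)
  then show thesis
    using d by (intro that[of "int j + int p ^ n * d"]) (simp_all add: algebra_simps power2_eq_square)
qed

section \<open>Counting primitive pairs up to unit multiples\<close>

text \<open>
  Equality up to a unit in the product of the integers modulo \<open>p ^ a\<close> and modulo \<open>p ^ b\<close>: two elements
  are related if and only if they generate the same cyclic subgroup. Pairs of integers represent
  pairs of residues.
\<close>

definition unit_multiple :: "nat \<Rightarrow> nat \<Rightarrow> nat \<Rightarrow> int \<times> int \<Rightarrow> int \<times> int \<Rightarrow> bool" where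
  "unit_multiple p a b q q' \<longleftrightarrow>
     (\<exists>k. \<not> int p dvd k \<and> [k * fst q = fst q'] (mod int p ^ a) \<and> [k * snd q = snd q'] (mod int p ^ b))"

lemma unit_multiple_sym:
  assumes "prime p" "unit_multiple p a b q q'"
  shows "unit_multiple p a b q' q"
proof -
  obtain k where k: "\<not> int p dvd k" "[k * fst q = fst q'] (mod int p ^ a)" "[k * snd q = snd q'] (mod int p ^ b)"
    using assms(2) by (auto simp: unit_multiple_def)
  obtain l where l: "\<not> int p dvd l" "[k * l = 1] (mod int p ^ (a + b))"
    using prime_power_unit_inverse[OF assms(1) k(1)] by blast
  have reverse: "[l * z' = z] (mod int p ^ c)" if "c \<le> a + b" "[k * z = z'] (mod int p ^ c)" for c z z'
  proof -
    have "[k * l = 1] (mod int p ^ c)"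
      using l(2) that(1) by (rule cong_dvd_modulus[OF _ le_imp_power_dvd])
    then have "[k * l * z = 1 * z] (mod int p ^ c)" by (rule cong_scalar_right)
    moreover have "[l * (k * z) = l * z'] (mod int p ^ c)"
      using that(2) by (rule cong_scalar_left)
    ultimately show ?thesis
      by (metis cong_sym cong_trans mult.assoc mult.commute mult_1)
  qed
  show ?thesis
    unfolding unit_multiple_def using l(1) reverse[OF _ k(2)] reverse[OF _ k(3)] by auto
qed

lemma unit_multiple_trans:
  assumes "prime p" "unit_multiple p a b q q'" "unit_multiple p a b q' q''"
  shows "unit_multiple p a b q q''"
proof -
  obtain k where k: "\<not> int p dvd k" "[k * fst q = fst q'] (mod int p ^ a)" "[k * snd q = snd q'] (mod int p ^ b)"
    using assms(2) by (auto simp: unit_multiple_def)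
  obtain l where l: "\<not> int p dvd l" "[l * fst q' = fst q''] (mod int p ^ a)" "[l * snd q' = snd q''] (mod int p ^ b)"
    using assms(3) by (auto simp: unit_multiple_def)
  have "\<not> int p dvd l * k"
    using k l assms(1) by (simp add: prime_dvd_mult_iff)
  moreover have "[l * k * fst q = fst q''] (mod int p ^ a)" "[l * k * snd q = snd q''] (mod int p ^ b)"
    using k l by (metis cong_scalar_left cong_trans mult.assoc)+
  ultimately show ?thesis unfolding unit_multiple_def by blast
qed

lemma unit_multiple_swap:
  "unit_multiple p a b (prod.swap q) (prod.swap q') \<longleftrightarrow> unit_multiple p b a q q'"
  by (auto simp: unit_multiple_def)

definition primitive_pairs :: "nat \<Rightarrow> (int \<times> int) set" where
  "primitive_pairs p = {(u, v). \<not> (int p dvd u \<and> int p dvd v)}"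

text \<open>
  The left side counts the representatives chosen in \<open>pair_reps\<close>. Increasing \<open>a\<close> by one adds
  \<open>totient (p ^ b) = p ^ (b - 1) * (p - 1)\<close>, and for \<open>a = b\<close> the sum telescopes to \<open>p ^ (b - 1)\<close>.
\<close>

lemma sum_totient_min:
  assumes "prime p" "0 < b" "b \<le> a"
  shows "p ^ b + (\<Sum>j<a. totient (p ^ min b j)) = p ^ (b - 1) * ((a - b) * (p - 1) + p + 1)"
  using assms(3)
proof (induction a rule: dec_induct)
  case base
  have "(\<Sum>j<Suc c. totient (p ^ j)) = p ^ c" for c
  proof (induction c)
    case (Suc c)
    have "p ^ c + p ^ c * (p - 1) = p ^ Suc c"
      using prime_gt_0_nat[OF assms(1)] by (cases p) (auto simp: algebra_simps)
    moreover have "totient (p ^ Suc c) = p ^ c * (p - 1)"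
      by (rule totient_prime_power_Suc[OF assms(1)])
    moreover have "(\<Sum>j<Suc (Suc c). totient (p ^ j)) = (\<Sum>j<Suc c. totient (p ^ j)) + totient (p ^ Suc c)"
      by (rule sum.lessThan_Suc)
    ultimately show ?case using Suc by metis
  qed simp
  from this[of "b - 1"] have "(\<Sum>j<b. totient (p ^ j)) = p ^ (b - 1)" using assms(2) by simp
  moreover have "(\<Sum>j<b. totient (p ^ min b j)) = (\<Sum>j<b. totient (p ^ j))"
    by (intro sum.cong) auto
  moreover have "p ^ b = p ^ (b - 1) * p" using assms(2) by (cases b) auto
  ultimately show ?case by simp
next
  case (step a)
  have "totient (p ^ b) = p ^ (b - 1) * (p - 1)"
    using assms by (simp add: totient_prime_power)
  moreover have "Suc a - b = Suc (a - b)" using step by simp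
  ultimately show ?case using step by (simp add: algebra_simps)
qed

text \<open>
  Representatives for \<open>b \<le> a\<close>. If the first entry is a unit it is scaled to \<open>1\<close>, and the second
  is then determined modulo \<open>p ^ b\<close>. Otherwise the second entry is scaled to \<open>1\<close>. The first is then
  \<open>p ^ (a - j) w\<close> with a unit \<open>w\<close> and \<open>j < a\<close>; it may still be multiplied by units congruent to \<open>1\<close>
  modulo \<open>p ^ b\<close>, and \<open>w\<close> counts only modulo \<open>p ^ j\<close>, so \<open>w\<close> is determined modulo \<open>p ^ min b j\<close>.
  For \<open>j = 0\<close> the convention \<open>totatives 1 = {1}\<close> supplies the single representative of the zero residue.
\<close>

definition pair_reps :: "nat \<Rightarrow> nat \<Rightarrow> nat \<Rightarrow> (int \<times> int) set" where
  "pair_reps p a b = (\<lambda>v. (1, int v)) ` {..<p ^ b} \<union>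
     (\<lambda>(j, w). (int (p ^ (a - j) * w), 1)) ` (SIGMA j:{..<a}. totatives (p ^ min b j))"

lemma totatives_prime_power_not_dvd:
  assumes "prime p" "w \<in> totatives (p ^ e)"
  shows "\<not> p dvd w"
proof (cases e)
  case 0
  then show ?thesis using assms prime_gt_1_nat[OF assms(1)] by simp
next
  case (Suc e')
  then show ?thesis using assms by (auto simp: in_totatives_iff coprime_commute dest: coprime_absorb_left)
qed

text \<open>
  Modulo \<open>p ^ a\<close> the number of factors \<open>p\<close> is well defined when numbers with more than \<open>a\<close> of them
  are counted as having \<open>a\<close>.
\<close>

lemma p_part_cong_unique:
  assumes "prime p" "i < a" "j < a" "\<not> int p dvd w" "\<not> int p dvd w'" 
    "[int p ^ (a - i) * w = int p ^ (a - j) * w'] (mod int p ^ a)"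
  shows "i = j"
proof -
  have *: False if "i < j" "j < a" "\<not> int p dvd w'"
     "[int p ^ (a - i) * w = int p ^ (a - j) * w'] (mod int p ^ a)" for i j w w'
  proof -
    have "int p ^ Suc (a - j) dvd int p ^ (a - i) * w"
      using that by (intro dvd_mult2 le_imp_power_dvd) simp
    moreover have "int p ^ Suc (a - j) dvd int p ^ a"
      using that by (intro le_imp_power_dvd) simp
    ultimately have "int p ^ Suc (a - j) dvd int p ^ (a - j) * w'"
      using that(4) cong_dvd_iff cong_dvd_modulus by metis
    then show False using that(3) prime_gt_0_nat[OF assms(1)] by (simp add: mult.commute[of "int p"])
  qed
  show ?thesis using *[of i j w' w] *[of j i w w'] assms by (meson cong_sym linorder_neqE_nat)
qed

text \<open>
  The factor \<open>k\<close> allows one lemma to serve both the injectivity of the parametrization (\<open>k = 1\<close>) and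
  the separation of different representatives.
\<close>

lemma pair_reps_second_unique:
  assumes p: "prime p" and "b \<le> a" and i: "i < a" and j: "j < a"
    and w: "w \<in> totatives (p ^ min b i)" and w': "w' \<in> totatives (p ^ min b j)"
    and k: "[k = 1] (mod int p ^ b)" "\<not> int p dvd k"
    and eq: "[k * int (p ^ (a - i) * w) = int (p ^ (a - j) * w')] (mod int p ^ a)"
  shows "i = j \<and> w = w'"
proof -
  have nd: "\<not> int p dvd k * int w" "\<not> int p dvd int w'"
    using totatives_prime_power_not_dvd[OF p w] totatives_prime_power_not_dvd[OF p w'] k(2) p
    by (auto simp: prime_dvd_mult_iff)
  have eq': "[int p ^ (a - i) * (k * int w) = int p ^ (a - j) * int w'] (mod int p ^ a)"
    using eq by (simp add: mult_ac)
  have ij: "i = j" by (rule p_part_cong_unique[OF p i j nd eq'])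
  have "int p ^ (a - i) * int p ^ i dvd int p ^ (a - i) * (k * int w - int w')"
    using eq' ij i by (simp add: cong_iff_dvd_diff algebra_simps flip: power_add)
  then have "[k * int w = int w'] (mod int p ^ i)"
    using prime_gt_0_nat[OF p] by (simp add: cong_iff_dvd_diff)
  then have "[k * int w = int w'] (mod int p ^ min b i)"
    by (rule cong_dvd_modulus) (simp add: le_imp_power_dvd)
  moreover have "[k * int w = 1 * int w] (mod int p ^ min b i)"
    by (intro cong_scalar_right cong_dvd_modulus[OF k(1)] le_imp_power_dvd) simp
  ultimately have "[int w = int w'] (mod int (p ^ min b i))"
    by (metis cong_sym cong_trans mult_1 of_nat_power)
  then have c: "[w = w'] (mod p ^ min b i)" by (simp only: cong_int_iff)
  define M where "M = p ^ min b i"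
  have "0 < w" "w \<le> M" "0 < w'" "w' \<le> M"
    using w w' ij by (auto simp: in_totatives_iff M_def)
  moreover have "w mod M = w' mod M"
    using c by (simp add: cong_def M_def)
  ultimately have "w = w'"
    by (cases "w = M"; cases "w' = M") auto
  with ij show ?thesis by simp
qed

lemma card_pair_reps:
  assumes p: "prime p" and "0 < b" "b \<le> a"
  shows "card (pair_reps p a b) = p ^ (b - 1) * ((a - b) * (p - 1) + p + 1)"
proof -
  have p1: "p > 1" by (rule prime_gt_1_nat[OF p])
  have inj: "inj_on (\<lambda>(j, w). (int (p ^ (a - j) * w), 1::int)) (SIGMA j:{..<a}. totatives (p ^ min b j))"
    using pair_reps_second_unique[OF p assms(3), of _ _ _ _ 1] p1
    by (fastforce simp: inj_on_def)
  have "card ((\<lambda>v. (1::int, int v)) ` {..<p ^ b}) = p ^ b"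
    by (subst card_image) (auto simp: inj_on_def)
  moreover have "card ((\<lambda>(j, w). (int (p ^ (a - j) * w), 1::int)) ` (SIGMA j:{..<a}. totatives (p ^ min b j)))
      = (\<Sum>j<a. totient (p ^ min b j))"
    by (subst card_image[OF inj]) (simp add: totient_def)
  moreover have "(\<lambda>v. (1::int, int v)) ` {..<p ^ b} \<inter>
      (\<lambda>(j, w). (int (p ^ (a - j) * w), 1::int)) ` (SIGMA j:{..<a}. totatives (p ^ min b j)) = {}"
    (is "?A \<inter> ?B = {}")
  proof (intro equals0I)
    fix z assume "z \<in> ?A \<inter> ?B"
    then obtain j w where "j < a" "1 = int (p ^ (a - j) * w)" by auto
    then have "p ^ (a - j) dvd 1"
      by (metis dvd_triv_left of_nat_1_eq_iff of_nat_eq_iff)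
    with \<open>j < a\<close> p1 show False by simp
  qed
  ultimately show ?thesis
    unfolding pair_reps_def using sum_totient_min[OF assms]
    by (subst card_Un_disjoint) auto
qed

lemma pair_reps_complete:
  assumes p: "prime p" and "0 < b" "b \<le> a" and uv: "(u, v) \<in> primitive_pairs p"
  shows "\<exists>q \<in> pair_reps p a b. unit_multiple p a b q (u, v)"
proof (cases "int p dvd u")
  case False
  have pb: "int p ^ b > 0" using prime_gt_0_nat[OF p] by simp
  obtain l where l: "[u * l = 1] (mod int p ^ b)"
    using prime_power_unit_inverse[OF p False] by blast
  define w where "w = nat ((l * v) mod int p ^ b)"
  have iw: "int w = (l * v) mod int p ^ b" using pb by (simp add: w_def)
  have "w < p ^ b" using pb iw by (metis of_nat_less_iff of_nat_power pos_mod_bound)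
  moreover have "[u * int w = v] (mod int p ^ b)"
  proof -
    have "[u * int w = u * (l * v)] (mod int p ^ b)"
      by (intro cong_scalar_left) (simp add: iw cong_def)
    moreover have "[u * l * v = 1 * v] (mod int p ^ b)"
      using l by (rule cong_scalar_right)
    ultimately show ?thesis by (metis cong_trans mult.assoc mult_1)
  qed
  ultimately show ?thesis
    using False by (intro bexI[of _ "(1, int w)"]) (auto simp: unit_multiple_def pair_reps_def)
next
  case True
  then have v: "\<not> int p dvd v" using uv by (simp add: primitive_pairs_def)
  obtain l where l: "\<not> int p dvd l" "[v * l = 1] (mod int p ^ a)"
    using prime_power_unit_inverse[OF p v] by blast
  have p1: "p > 1" by (rule prime_gt_1_nat[OF p])
  \<comment> \<open>Scale the second entry to \<open>1\<close> and split off the power of \<open>p\<close> in the first entry.\<close>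
  have "\<exists>j<a. \<exists>w0. \<not> int p dvd w0 \<and> [u = int p ^ (a - j) * (v * w0)] (mod int p ^ a)"
  proof (cases "[l * u = 0] (mod int p ^ a)")
    case True
    then have "int p ^ a dvd l * u" by (simp add: cong_0_iff)
    moreover have "coprime (int p ^ a) l"
      using l(1) p prime_imp_coprime[of "int p" l] by simp
    ultimately have "int p ^ a dvd u" by (simp add: coprime_dvd_mult_right_iff)
    then have "[u = int p ^ (a - 0) * (v * 1)] (mod int p ^ a)"
      by (simp add: cong_iff_dvd_diff)
    then show ?thesis using assms p1 by (intro exI[of _ 0] conjI exI[of _ 1]) auto
  next
    case False
    then have "l * u \<noteq> 0" by (metis cong_refl)
    then obtain i w0 where w0: "l * u = int p ^ i * w0" "\<not> int p dvd w0"
      using multiplicity_decompose'[of "l * u" "int p"] p1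
      by (metis int_one_le_iff_zero_less nat_int not_prime_unit of_nat_0_less_iff p prime_nat_int_transfer)
    have "i < a"
      using False w0(1) by (metis cong_0_iff dvd_mult2 le_imp_power_dvd not_le)
    moreover have "i > 0"
      using True w0 by (metis dvd_mult gr0I mult_1 power_0)
    moreover have "[v * l * u = 1 * u] (mod int p ^ a)" using l(2) by (rule cong_scalar_right)
    then have "[u = int p ^ i * (v * w0)] (mod int p ^ a)"
      using w0(1) by (metis cong_sym mult.assoc mult.left_commute mult_1)
    ultimately show ?thesis using w0
      by (intro exI[of _ "a - i"] conjI exI[of _ w0]) (auto simp: cong_sym_eq mult_ac)
  qed
  then obtain j w0 where j: "j < a" "\<not> int p dvd w0" "[u = int p ^ (a - j) * (v * w0)] (mod int p ^ a)"
    by blast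
  define e where "e = min b j"
  have "\<exists>w\<in>totatives (p ^ e). [int w = w0] (mod int p ^ e)"
  proof (cases "e = 0")
    case False
    define w where "w = nat (w0 mod int p ^ e)"
    have iw: "int w = w0 mod int p ^ e" using p1 by (simp add: w_def)
    have c: "[int w = w0] (mod int p ^ e)" by (simp add: iw cong_def)
    have "int p dvd int p ^ e" using False by (simp add: dvd_power)
    with c j(2) have "\<not> int p dvd int w" using cong_dvd_iff cong_dvd_modulus by metis
    moreover have "w < p ^ e" using p1 iw
      by (metis of_nat_less_iff of_nat_power pos_mod_bound of_nat_0_less_iff zero_less_power gr0I not_one_less_zero)
    ultimately have "w \<in> totatives (p ^ e)"
      using p prime_imp_coprime[of p w]
      by (auto simp: in_totatives_iff coprime_commute intro!: gr0I)
    with c show ?thesis by blast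
  qed auto
  then obtain w where w: "w \<in> totatives (p ^ e)" "[int w = w0] (mod int p ^ e)" by blast
  have nw: "\<not> int p dvd int w" using totatives_prime_power_not_dvd[OF p w(1)] by simp
  \<comment> \<open>The unit \<open>k\<close> must bring \<open>w\<close> to \<open>v w0\<close> modulo \<open>p ^ j\<close> and \<open>1\<close> to \<open>v\<close> modulo \<open>p ^ b\<close>. The finer\<close>
  \<comment> \<open>modulus decides: for \<open>j \<le> b\<close> take \<open>v\<close> itself, for \<open>b < j\<close> solve the first congruence.\<close>
  obtain k where k: "\<not> int p dvd k" "[k * int w = v * w0] (mod int p ^ j)" "[k = v] (mod int p ^ b)"
  proof (cases "j \<le> b")
    case True
    then have "[v * int w = v * w0] (mod int p ^ j)"
      using w(2) by (simp add: e_def cong_scalar_left)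
    with v show ?thesis by (intro that[of v]) auto
  next
    case False
    obtain z where z: "\<not> int p dvd z" "[int w * z = 1] (mod int p ^ j)"
      using prime_power_unit_inverse[OF p nw] by blast
    have "[int w * z = 1] (mod int p ^ b)"
      using False by (intro cong_dvd_modulus[OF z(2)] le_imp_power_dvd) simp
    moreover have "[int w * z = w0 * z] (mod int p ^ b)"
      using w(2) False by (intro cong_scalar_right) (simp add: e_def)
    ultimately have "[w0 * z = 1] (mod int p ^ b)"
      by (metis cong_sym cong_trans)
    then have "[v * (w0 * z) = v * 1] (mod int p ^ b)" by (rule cong_scalar_left)
    moreover have "[v * w0 * (int w * z) = v * w0 * 1] (mod int p ^ j)"
      using z(2) by (rule cong_scalar_left)
    moreover have "\<not> int p dvd v * w0 * z"
      using v j(2) z(1) p by (simp add: prime_dvd_mult_iff)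
    ultimately show ?thesis by (intro that[of "v * w0 * z"]) (auto simp: mult_ac)
  qed
  have "[int p ^ (a - j) * (k * int w) = int p ^ (a - j) * (v * w0)] (mod int p ^ a)"
  proof -
    have "int p ^ (a - j) * int p ^ j dvd int p ^ (a - j) * (k * int w - v * w0)"
      using k(2) by (simp add: cong_iff_dvd_diff)
    then show ?thesis using j(1) by (simp add: cong_iff_dvd_diff algebra_simps flip: power_add)
  qed
  then have "[k * int (p ^ (a - j) * w) = u] (mod int p ^ a)"
    using j(3) by (simp add: mult_ac) (metis cong_sym cong_trans)
  then have "unit_multiple p a b (int (p ^ (a - j) * w), 1) (u, v)"
    using k by (auto simp: unit_multiple_def)
  moreover have "(int (p ^ (a - j) * w), 1) \<in> pair_reps p a b"
    using j(1) w(1) by (auto simp: pair_reps_def e_def intro!: image_eqI[of _ _ "(j, w)"])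
  ultimately show ?thesis by blast
qed

lemma pair_reps_separated:
  assumes p: "prime p" and "0 < b" "b \<le> a"
    and q: "q \<in> pair_reps p a b" "q' \<in> pair_reps p a b" and um: "unit_multiple p a b q q'"
  shows "q = q'"
proof -
  let ?A = "(\<lambda>v. (1::int, int v)) ` {..<p ^ b}"
  let ?B = "(\<lambda>(j, w). (int (p ^ (a - j) * w), 1::int)) ` (SIGMA j:{..<a}. totatives (p ^ min b j))"
  have p_dvd: "int p dvd int p ^ a" "int p dvd int p ^ b" using assms by (auto intro: dvd_power)
  have mixed: False if r: "r \<in> ?A" "r' \<in> ?B" "unit_multiple p a b r r'" for r r'
  proof -
    obtain j w k where "j < a" "\<not> int p dvd k" "[k = int (p ^ (a - j) * w)] (mod int p ^ a)"
      using r by (auto simp: unit_multiple_def)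
    moreover have "int p dvd int (p ^ (a - j) * w)"
      using \<open>j < a\<close> by (auto intro: dvd_mult2 dvd_power)
    ultimately show False using p_dvd(1) cong_dvd_iff cong_dvd_modulus by metis
  qed
  from q consider "q \<in> ?A" "q' \<in> ?A" | "q \<in> ?B" "q' \<in> ?B" | "q \<in> ?A" "q' \<in> ?B" | "q \<in> ?B" "q' \<in> ?A"
    unfolding pair_reps_def by blast
  then show ?thesis
  proof cases
    case 1
    then obtain v v' k where v: "q = (1, int v)" "q' = (1, int v')" "v < p ^ b" "v' < p ^ b"
        and k: "[k = 1] (mod int p ^ a)" "[k * int v = int v'] (mod int p ^ b)"
      using um by (auto simp: unit_multiple_def)
    have "[k = 1] (mod int p ^ b)"
      using k(1) assms(3) by (auto intro: cong_dvd_modulus le_imp_power_dvd)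
    then have "[k * int v = 1 * int v] (mod int p ^ b)" by (rule cong_scalar_right)
    with k(2) have "[int v = int v'] (mod int (p ^ b))"
      by (metis cong_sym cong_trans mult_1 of_nat_power)
    then have "[v = v'] (mod p ^ b)" by (simp only: cong_int_iff)
    with v show ?thesis by (simp add: cong_def)
  next
    case 2
    then obtain j w j' w' k where
      r: "q = (int (p ^ (a - j) * w), 1)" "q' = (int (p ^ (a - j') * w'), 1)"
        "j < a" "j' < a" "w \<in> totatives (p ^ min b j)" "w' \<in> totatives (p ^ min b j')"
      and k: "\<not> int p dvd k" "[k * int (p ^ (a - j) * w) = int (p ^ (a - j') * w')] (mod int p ^ a)"
        "[k = 1] (mod int p ^ b)"
      using um by (auto simp: unit_multiple_def)
    have "j = j' \<and> w = w'"
      by (rule pair_reps_second_unique[OF p assms(3) r(3-6) k(3,1,2)])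
    with r show ?thesis by simp
  next
    case 3
    with mixed um show ?thesis by blast
  next
    case 4
    with mixed unit_multiple_sym[OF p um] show ?thesis by blast
  qed
qed

lemma pair_reps_primitive:
  assumes "prime p"
  shows "pair_reps p a b \<subseteq> primitive_pairs p"
  using prime_gt_1_nat[OF assms] by (auto simp: pair_reps_def primitive_pairs_def)

proposition primitive_pairs_transversal:
  assumes p: "prime p" and "0 < a" "0 < b"
  obtains T where "T \<subseteq> primitive_pairs p" "card T = g_fun p a b"
    "\<And>q. q \<in> primitive_pairs p \<Longrightarrow> \<exists>t\<in>T. unit_multiple p a b t q"
    "\<And>t t'. \<lbrakk>t \<in> T; t' \<in> T; unit_multiple p a b t t'\<rbrakk> \<Longrightarrow> t = t'"
proof (cases "b \<le> a")
  case True
  show thesis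
  proof (rule that)
    show "card (pair_reps p a b) = g_fun p a b"
      using card_pair_reps[OF p assms(3) True] True by (simp add: g_fun_def Let_def)
  qed (use pair_reps_primitive[OF p] pair_reps_complete[OF p assms(3) True]
         pair_reps_separated[OF p assms(3) True] in auto)
next
  case False
  let ?T = "prod.swap ` pair_reps p b a"
  have ab: "a \<le> b" using False by simp
  show thesis
  proof (rule that)
    show "?T \<subseteq> primitive_pairs p"
      using pair_reps_primitive[OF p, of b a] by (auto simp: primitive_pairs_def)
    show "card ?T = g_fun p a b"
      using card_pair_reps[OF p assms(2) ab] False
      by (subst card_image) (auto simp: g_fun_def Let_def)
    show "\<exists>t\<in>?T. unit_multiple p a b t q" if "q \<in> primitive_pairs p" for q
    proof -
      have "(snd q, fst q) \<in> primitive_pairs p" using that by (auto simp: primitive_pairs_def)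
      then obtain t where "t \<in> pair_reps p b a" "unit_multiple p b a t (snd q, fst q)"
        using pair_reps_complete[OF p assms(2) ab] by blast
      then show ?thesis
        by (intro bexI[of _ "prod.swap t"]) (auto simp: unit_multiple_def)
    qed
    show "t = t'" if "t \<in> ?T" "t' \<in> ?T" "unit_multiple p a b t t'" for t t'
      using that pair_reps_separated[OF p assms(2) ab] unit_multiple_swap by blast
  qed
qed

section \<open>Cyclic subgroups and their conjugates\<close>

lemma (in group) conjugation_hom:
  assumes "z \<in> carrier G"
  shows "group_hom G G (\<lambda>g. inv z \<otimes> g \<otimes> z)"
proof -
  have "inv z \<otimes> (g \<otimes> h) \<otimes> z = (inv z \<otimes> g \<otimes> z) \<otimes> (inv z \<otimes> h \<otimes> z)"
    if "g \<in> carrier G" "h \<in> carrier G" for g h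
  proof -
    have "z \<otimes> (inv z \<otimes> (h \<otimes> z)) = h \<otimes> z"
      using assms that by (simp flip: m_assoc)
    then show ?thesis using assms that by (simp add: m_assoc)
  qed
  then show ?thesis
    using assms by (intro group_hom.intro group_hom_axioms.intro homI) (auto simp: is_group)
qed

lemma (in group) conjugate_eqI:
  assumes "z \<in> carrier G" "g \<in> carrier G" "h \<in> carrier G" "z \<otimes> h = g \<otimes> z"
  shows "h = inv z \<otimes> g \<otimes> z"
  using assms by (simp add: m_assoc inv_solve_left)

lemma (in group) conjugate_trans:
  assumes "z \<in> carrier G" "w \<in> carrier G" "g \<in> carrier G"
  shows "inv w \<otimes> (inv z \<otimes> g \<otimes> z) \<otimes> w = inv (z \<otimes> w) \<otimes> g \<otimes> (z \<otimes> w)"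
  using assms by (simp add: m_assoc inv_mult_group)

abbreviation (in group) powers :: "'a \<Rightarrow> 'a set" where
  "powers g \<equiv> range (\<lambda>k::int. g [^] k)"

lemma (in group) powers_mono_power:
  assumes "g \<in> carrier G"
  shows "powers (g [^] (k::int)) \<subseteq> powers g"
  using assms by (auto simp: int_pow_pow)

lemma (in group) mem_powers: "g \<in> carrier G \<Longrightarrow> g \<in> powers g"
  by (rule range_eqI[of _ _ 1]) simp

lemma (in group) cyclic_subgroup_iff_powers:
  "cyclic_subgroup G C \<longleftrightarrow> (\<exists>g\<in>carrier G. C = powers g)"
proof
  assume "cyclic_subgroup G C"
  then have C: "subgroup C G" "cyclic_group (subgroup_generated G C)"
    by (auto simp: cyclic_subgroup_def)
  interpret H: group "subgroup_generated G C" by simp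
  have c: "carrier (subgroup_generated G C) = C"
    using C(1) by (rule subgroup.carrier_subgroup_generated_subgroup)
  obtain g where "g \<in> C" "C = range (\<lambda>k::int. g [^]\<^bsub>subgroup_generated G C\<^esub> k)"
    using C(2) H.cyclic_group c by metis
  then show "\<exists>g\<in>carrier G. C = powers g"
    using c subgroup.subset[OF C(1)] by (auto simp: int_pow_subgroup_generated)
next
  assume "\<exists>g\<in>carrier G. C = powers g"
  then obtain g where g: "g \<in> carrier G" "C = powers g" by blast
  have C: "subgroup C G" using g subgroup_of_powers by simp
  have c: "carrier (subgroup_generated G C) = C"
    using C by (rule subgroup.carrier_subgroup_generated_subgroup)
  interpret H: group "subgroup_generated G C" by simp
  have "g \<in> C" using g mem_powers by simp
  then have "C = range (\<lambda>k::int. g [^]\<^bsub>subgroup_generated G C\<^esub> k)"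
    using g c by (simp add: int_pow_subgroup_generated)
  then have "cyclic_group (subgroup_generated G C)"
    using H.cyclic_group c \<open>g \<in> C\<close> by metis
  then show "cyclic_subgroup G C" using C by (simp add: cyclic_subgroup_def)
qed

lemma (in group) conjugacy_rel_powers:
  assumes "g \<in> carrier G"
  shows "(powers g, D) \<in> conjugacy_rel G \<longleftrightarrow> (\<exists>z\<in>carrier G. D = powers (inv z \<otimes> g \<otimes> z))"
proof -
  have "(\<lambda>h. inv z \<otimes> h \<otimes> z) ` powers g = powers (inv z \<otimes> g \<otimes> z)" if "z \<in> carrier G" for z
  proof -
    interpret c: group_hom G G "\<lambda>h. inv z \<otimes> h \<otimes> z"
      by (rule conjugation_hom[OF that])
    show ?thesis using c.hom_int_pow[OF assms] by (simp add: image_image)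
  qed
  then show ?thesis by (auto simp: conjugacy_rel_def)
qed

text \<open>
  The relation \<open>conjugacy_rel\<close> is not confined to maximal cyclic subgroups, so it is no equivalence on
  that set in the sense of \<open>equiv\<close>; this lemma replaces the usual criterion for equality of classes.
\<close>

lemma (in group) conjugacy_class_eq_iff:
  assumes "g \<in> carrier G" "h \<in> carrier G"
  shows "conjugacy_rel G `` {powers g} = conjugacy_rel G `` {powers h} \<longleftrightarrow>
    (powers g, powers h) \<in> conjugacy_rel G"
proof
  assume "conjugacy_rel G `` {powers g} = conjugacy_rel G `` {powers h}"
  moreover have "(powers h, powers h) \<in> conjugacy_rel G"
    unfolding conjugacy_rel_powers[OF assms(2)] using assms by (intro bexI[of _ \<one>]) auto
  ultimately show "(powers g, powers h) \<in> conjugacy_rel G" by blast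
next
  assume "(powers g, powers h) \<in> conjugacy_rel G"
  then obtain z where z: "z \<in> carrier G" "powers h = powers (inv z \<otimes> g \<otimes> z)"
    using conjugacy_rel_powers assms(1) by blast
  have gz: "inv z \<otimes> g \<otimes> z \<in> carrier G" using z assms by simp
  have "(powers h, D) \<in> conjugacy_rel G \<longleftrightarrow> (powers g, D) \<in> conjugacy_rel G" for D
    unfolding z(2) conjugacy_rel_powers[OF gz] conjugacy_rel_powers[OF assms(1)]
  proof safe
    fix w assume "w \<in> carrier G"
    then show "\<exists>z'\<in>carrier G. powers (inv w \<otimes> (inv z \<otimes> g \<otimes> z) \<otimes> w) = powers (inv z' \<otimes> g \<otimes> z')"
      using z(1) assms(1) by (intro bexI[of _ "z \<otimes> w"]) (simp_all add: conjugate_trans)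
  next
    fix w assume w: "w \<in> carrier G"
    have "z \<otimes> (inv z \<otimes> w) = w" using z(1) w by (simp flip: m_assoc)
    then show "\<exists>w'\<in>carrier G. powers (inv w \<otimes> g \<otimes> w) = powers (inv w' \<otimes> (inv z \<otimes> g \<otimes> z) \<otimes> w')"
      using z(1) w assms(1) by (intro bexI[of _ "inv z \<otimes> w"]) (simp_all add: conjugate_trans)
  qed
  then show "conjugacy_rel G `` {powers g} = conjugacy_rel G `` {powers h}" by blast
qed

lemma (in group) powers_unit_power:
  assumes g: "g \<in> carrier G" and p: "prime p" and ord: "g [^] (p ^ N) = \<one>" and k: "\<not> int p dvd k"
  shows "powers (g [^] k) = powers g"
proof
  obtain l where "[k * l = 1] (mod int p ^ N)"
    using prime_power_unit_inverse[OF p k] by blast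
  then obtain d where d: "k * l = 1 + int (p ^ N) * d"
    by (metis cong_iff_lin cong_sym_eq of_nat_power)
  have "(g [^] k) [^] l = g \<otimes> (g [^] int (p ^ N)) [^] d"
    using g by (simp add: int_pow_pow int_pow_mult d)
  then have "(g [^] k) [^] l = g" using g ord by (simp add: int_pow_int del: of_nat_power)
  then show "powers g \<subseteq> powers (g [^] k)"
    using powers_mono_power[of "g [^] k" l] g by simp
qed (rule powers_mono_power[OF g])

lemma (in group) cong_additive_int_pow:
  fixes f :: "'a \<Rightarrow> int" and k :: int
  assumes add: "\<And>g h. \<lbrakk>g \<in> carrier G; h \<in> carrier G\<rbrakk> \<Longrightarrow> [f (g \<otimes> h) = f g + f h] (mod m)"
    and g: "g \<in> carrier G"
  shows "[f (g [^] k) = k * f g] (mod m)"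
proof -
  have "[f (\<one> \<otimes> \<one>) = f \<one> + f \<one>] (mod m)" by (intro add) simp_all
  then have one: "[f \<one> = 0] (mod m)" by (simp add: cong_iff_dvd_diff)
  have nat: "[f (g [^] (i::nat)) = int i * f g] (mod m)" for i
  proof (induction i)
    case (Suc i)
    have "[f (g [^] i \<otimes> g) = f (g [^] i) + f g] (mod m)" using g by (intro add) auto
    also have "[f (g [^] i) + f g = int i * f g + f g] (mod m)" by (intro cong_add Suc cong_refl)
    finally show ?case by (simp add: algebra_simps)
  qed (simp add: one)
  show ?thesis
  proof (cases k rule: int_cases2)
    case (nonneg i)
    then show ?thesis using nat by (simp add: int_pow_int)
  next
    case (nonpos i)
    have "[f (g [^] k \<otimes> g [^] i) = f (g [^] k) + f (g [^] i)] (mod m)" using g by (intro add) auto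
    moreover have "g [^] k \<otimes> g [^] i = \<one>" using g nonpos by (simp add: int_pow_neg_int)
    ultimately have "[f (g [^] k) + int i * f g = 0] (mod m)"
      using one nat[of i] by (metis cong_add_lcancel cong_sym cong_trans)
    then show ?thesis by (simp add: nonpos cong_iff_dvd_diff)
  qed
qed

section \<open>Metacyclic groups in normal form\<close>

text \<open>
  The relations alone, with \<open>\<kappa>\<close> in the role of \<open>\<alpha> - \<epsilon>\<close> and \<open>n\<close> in that of \<open>\<alpha> - \<delta>\<close>. They suffice
  to compute with the elements \<open>y ^ j x ^ i\<close> and to show that these form a subgroup; that \<open>x\<close> and \<open>y\<close>
  generate the group is added in the next locale.
\<close>

locale metacyclic_relations = group G for G (structure) +
  fixes x y :: 'a and p \<alpha> \<beta> \<kappa> n :: nat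
  assumes p: "prime p"
    and x [simp]: "x \<in> carrier G" and y [simp]: "y \<in> carrier G"
    and x_power: "x [^] (p ^ \<alpha>) = \<one>"
    and y_power: "y [^] (p ^ \<beta>) = x [^] (p ^ \<kappa>)"
    and x_conj: "inv y \<otimes> x \<otimes> y = x [^] (p ^ n + 1)"
    and n_pos: "0 < n" and n_two: "p = 2 \<longrightarrow> 1 < n"
begin

text \<open>
  The exponent of \<open>y\<close> is a natural number because moving \<open>x\<close> past \<open>y ^ j\<close> raises it to the power
  \<open>r ^ j\<close>; the exponent of \<open>x\<close> is an integer so that congruences may be subtracted.
\<close>

definition el :: "nat \<Rightarrow> int \<Rightarrow> 'a" where "el j i = y [^] j \<otimes> x [^] i"

definition r :: int where "r = 1 + int p ^ n"

lemma el_closed [simp]: "el j i \<in> carrier G" by (simp add: el_def)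

lemma x_pow_cong:
  assumes "[i = i'] (mod int p ^ \<alpha>)"
  shows "x [^] i = x [^] (i'::int)"
proof -
  obtain d where "i = i' + int (p ^ \<alpha>) * d"
    using assms by (metis cong_iff_lin cong_sym_eq of_nat_power)
  moreover have "x [^] (int (p ^ \<alpha>) * d) = (x [^] int (p ^ \<alpha>)) [^] d" by (simp add: int_pow_pow)
  ultimately show ?thesis by (simp add: int_pow_mult int_pow_int x_power del: of_nat_power)
qed

lemma x_y_commute: "x [^] (i::int) \<otimes> y [^] (l::nat) = y [^] l \<otimes> x [^] (i * r ^ l)"
proof (induction l)
  case (Suc l)
  interpret c: group_hom G G "\<lambda>g. inv y \<otimes> g \<otimes> y" by (rule conjugation_hom) simp
  have "inv y \<otimes> x \<otimes> y = x [^] r"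
    using x_conj int_pow_int[of G x "p ^ n + 1"] by (simp add: r_def add.commute)
  then have "inv y \<otimes> x [^] k \<otimes> y = x [^] (r * k)" for k :: int
    using c.hom_int_pow[of x k] by (simp add: int_pow_pow)
  then have one: "x [^] k \<otimes> y = y \<otimes> x [^] (r * k)" for k :: int
    by (metis inv_solve_left' int_pow_closed m_assoc m_closed x y inv_closed)
  have "x [^] i \<otimes> y [^] Suc l = (x [^] i \<otimes> y [^] l) \<otimes> y" by (simp add: m_assoc)
  also have "\<dots> = y [^] l \<otimes> (x [^] (i * r ^ l) \<otimes> y)" by (simp add: Suc m_assoc)
  also have "\<dots> = y [^] Suc l \<otimes> x [^] (i * r ^ Suc l)" by (simp add: one m_assoc mult_ac)
  finally show ?case .
qed simp

lemma el_mult: "el j i \<otimes> el l m = el (j + l) (i * r ^ l + m)"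
proof -
  have "el j i \<otimes> el l m = y [^] j \<otimes> (x [^] i \<otimes> y [^] l) \<otimes> x [^] m"
    by (simp add: el_def m_assoc)
  then show ?thesis by (simp add: x_y_commute el_def m_assoc int_pow_mult flip: nat_pow_mult)
qed

lemma el_pow: "el j i [^] (k::nat) = el (j * k) (i * (\<Sum>t<k. (r ^ j) ^ t))"
proof (induction k)
  case (Suc k)
  have "(\<Sum>t<Suc k. (r ^ j) ^ t) = 1 + r ^ j * (\<Sum>t<k. (r ^ j) ^ t)"
    unfolding sum.lessThan_Suc_shift by (simp add: sum_distrib_left)
  then show ?case by (simp add: Suc el_mult algebra_simps)
qed (simp add: el_def)

lemma el_0_right: "el j 0 = y [^] j"
  by (simp add: el_def)

lemma y_pow_multiple: "y [^] (p ^ \<beta> * m) = x [^] (int p ^ \<kappa> * int m)"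
proof -
  have "y [^] (p ^ \<beta> * m) = (x [^] (p ^ \<kappa>)) [^] m" by (simp add: y_power flip: nat_pow_pow)
  also have "\<dots> = x [^] (p ^ \<kappa> * m)" by (simp add: nat_pow_pow)
  finally show ?thesis by (simp flip: int_pow_int)
qed

text \<open>
  Writing the inverse of \<open>y\<close> as a positive power lets normal forms absorb it with \<open>el_mult\<close>.
\<close>

lemma inv_y: "inv y = el (p ^ (\<beta> + \<alpha>) - 1) 0"
proof (rule inv_equality)
  have "y [^] (p ^ (\<beta> + \<alpha>)) = x [^] (int p ^ \<kappa> * int (p ^ \<alpha>))"
    unfolding power_add by (rule y_pow_multiple)
  also have "\<dots> = x [^] (0::int)" by (rule x_pow_cong) (simp add: cong_0_iff)
  finally have "y [^] (p ^ (\<beta> + \<alpha>)) = \<one>" by simp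
  moreover have "p ^ (\<beta> + \<alpha>) = Suc (p ^ (\<beta> + \<alpha>) - 1)"
    using prime_gt_0_nat[OF p] by simp
  ultimately show "el (p ^ (\<beta> + \<alpha>) - 1) 0 \<otimes> y = \<one>"
    by (metis el_0_right nat_pow_Suc)
qed auto

lemma normal_form_mult:
  assumes "g \<in> range (case_prod el)" "h \<in> {x, inv x, y, inv y}"
  shows "g \<otimes> h \<in> range (case_prod el)"
proof -
  obtain j i where g: "g = el j i" using assms(1) by auto
  have "inv x = el 0 (-1)" by (simp add: el_def int_pow_neg)
  moreover have "x = el 0 1" "y = el 1 0" by (simp_all add: el_def)
  ultimately obtain l m where "h = el l m" using assms(2) inv_y by blast
  then show ?thesis by (auto simp: g el_mult)
qed

end

locale positive_metacyclic = metacyclic_relations +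
  assumes normal_form: "carrier G = range (case_prod el)"
begin

lemma obtain_el:
  assumes "g \<in> carrier G"
  obtains j i where "g = el j i"
  using assms by (auto simp: normal_form)

lemma torsion:
  assumes "g \<in> carrier G"
  shows "g [^] (p ^ (\<beta> + \<alpha>)) = \<one>"
proof -
  obtain j i where g: "g = el j i" using assms by (rule obtain_el)
  obtain i' where "g [^] (p ^ \<beta>) = x [^] (i'::int)"
    unfolding g el_pow
    by (simp add: el_def y_pow_multiple mult.commute[of j] flip: int_pow_mult)
  then have "g [^] (p ^ (\<beta> + \<alpha>)) = (x [^] i') [^] int (p ^ \<alpha>)"
    using assms by (simp add: power_add int_pow_int del: of_nat_power flip: nat_pow_pow)
  also have "\<dots> = x [^] (i' * int (p ^ \<alpha>))" by (simp add: int_pow_pow)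
  also have "\<dots> = x [^] (0::int)" by (rule x_pow_cong) (simp add: cong_0_iff)
  finally show ?thesis by simp
qed

lemma r_cong_1: "[r = 1] (mod int p ^ n)" by (simp add: r_def cong_iff_dvd_diff)

text \<open>
  A primitive element is conjugate to everything in its coset of \<open>\<langle>x ^ (p ^ n)\<rangle>\<close>. If \<open>p\<close> does not
  divide \<open>i\<close>, conjugation by \<open>y ^ k\<close> turns \<open>i\<close> into \<open>i r ^ k\<close>, and the powers of \<open>r\<close> exhaust the
  residues congruent to \<open>1\<close> modulo \<open>p ^ n\<close>. If \<open>p\<close> does not divide \<open>j\<close>, conjugation by \<open>x ^ k\<close>
  subtracts \<open>k (r ^ j - 1)\<close> from \<open>i\<close>, and \<open>r ^ j - 1\<close> is \<open>p ^ n\<close> times a unit.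
\<close>

lemma el_conjugate:
  assumes prim: "\<not> (p dvd j \<and> int p dvd i)" and c: "[i' = i] (mod int p ^ n)"
  shows "\<exists>z\<in>carrier G. el j i' = inv z \<otimes> el j i \<otimes> z"
proof (cases "int p dvd i")
  case False
  obtain l where l: "[i * l = 1] (mod int p ^ (n + \<alpha>))"
    using prime_power_unit_inverse[OF p False] by blast
  have "[l * i' = l * i] (mod int p ^ n)" using c by (rule cong_scalar_left)
  also have "[l * i = 1] (mod int p ^ n)"
    using cong_dvd_modulus[OF l le_imp_power_dvd[of n "n + \<alpha>"]] by (simp add: mult.commute)
  finally obtain k where "[r ^ k = l * i'] (mod int p ^ (n + \<alpha>))"
    using principal_unit_power[OF p n_pos n_two] unfolding r_def by blast
  then have "[i * r ^ k = i * (l * i')] (mod int p ^ (n + \<alpha>))" by (rule cong_scalar_left)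
  also have "[i * (l * i') = 1 * i'] (mod int p ^ (n + \<alpha>))"
    unfolding mult.assoc[symmetric] using l by (rule cong_scalar_right)
  finally have "[i' = i * r ^ k] (mod int p ^ \<alpha>)"
    by (simp add: cong_sym_eq) (erule cong_dvd_modulus, simp add: le_imp_power_dvd)
  then have "el k 0 \<otimes> el j i' = el j i \<otimes> el k 0"
    by (simp add: el_mult add.commute) (simp add: el_def x_pow_cong)
  then show ?thesis by (intro bexI[of _ "el k 0"] conjugate_eqI) auto
next
  case True
  then have "\<not> p dvd j" using prim by blast
  then obtain w where w: "r ^ j = 1 + int p ^ n * w" "\<not> int p dvd w"
    using power_minus_one_unit[OF p n_pos] unfolding r_def by metis
  obtain l where l: "[w * l = 1] (mod int p ^ \<alpha>)"
    using prime_power_unit_inverse[OF p w(2)] by blast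
  obtain d where d: "i = i' + int p ^ n * d"
    using c by (metis cong_iff_lin)
  have "[int p ^ n * d * (w * l) = int p ^ n * d * 1] (mod int p ^ \<alpha>)"
    using l by (rule cong_scalar_left)
  then have "[d * l * r ^ j + i' = i + d * l] (mod int p ^ \<alpha>)"
    by (simp add: w d cong_iff_dvd_diff algebra_simps)
  then have "el 0 (d * l) \<otimes> el j i' = el j i \<otimes> el 0 (d * l)"
    by (simp add: el_mult) (simp add: el_def x_pow_cong)
  then show ?thesis by (intro bexI[of _ "el 0 (d * l)"] conjugate_eqI) auto
qed

text \<open>
  The \<open>p\<close>-th power of \<open>y ^ j x ^ k\<close> is \<open>y ^ (p j) x ^ (k S)\<close>, where the geometric sum \<open>S\<close> is \<open>p\<close> times a
  unit; that unit can be divided out of the exponent of \<open>x\<close>.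
\<close>

lemma el_multiple_is_power:
  obtains h where "h \<in> carrier G" "el (p * j) (int p * i) = h [^] p"
proof -
  have pn: "int p dvd int p ^ n" using n_pos by (simp add: dvd_power)
  have s: "[r ^ j = 1 ^ j] (mod int p ^ n)" by (intro cong_pow r_cong_1)
  then have "int p ^ n dvd r ^ j - 1" by (simp add: cong_iff_dvd_diff)
  moreover have "4 dvd int p ^ n" if "p = 2"
    using le_imp_power_dvd[of 2 n "2::int"] n_two that by simp
  ultimately obtain w where w: "(\<Sum>t<p. (r ^ j) ^ t) = int p * w" "\<not> int p dvd w"
    using geometric_sum_prime_unit[OF p, of "r ^ j"] pn dvd_trans by blast
  obtain l where l: "[w * l = 1] (mod int p ^ \<alpha>)"
    using prime_power_unit_inverse[OF p w(2)] by blast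
  then have "[int p * i * (w * l) = int p * i * 1] (mod int p ^ \<alpha>)" by (rule cong_scalar_left)
  then have "x [^] (int p * i) = x [^] (i * l * (int p * w))"
    by (intro x_pow_cong) (simp add: cong_sym_eq mult_ac)
  then have "el (p * j) (int p * i) = el j (i * l) [^] p"
    by (simp add: el_pow w(1) mult.commute[of p]) (simp add: el_def)
  then show thesis by (intro that[of "el j (i * l)"]) auto
qed

end

text \<open>
  Coordinates on the abelianization: \<open>u\<close> modulo \<open>p ^ a\<close> and \<open>v\<close> modulo \<open>p ^ b\<close> are homomorphisms with
  \<open>x \<mapsto> (1, s)\<close> and \<open>y \<mapsto> (t, 1)\<close>. The condition \<open>s t = 0\<close> makes this a change of basis of
  determinant \<open>1\<close>. The last assumption puts the common kernel of \<open>u\<close> and \<open>v\<close> inside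
  \<open>\<langle>x ^ (p ^ n)\<rangle>\<close>: if \<open>y ^ j x ^ i\<close> lies in it, then \<open>y ^ j\<close> is the power \<open>x ^ (p ^ \<kappa> j')\<close> and the
  total exponent of \<open>x\<close> is divisible by \<open>p ^ n\<close>.
\<close>

locale abelianized_metacyclic = positive_metacyclic +
  fixes u v :: "'a \<Rightarrow> int" and a b :: nat and s t :: int
  assumes a_pos: "0 < a" and b_pos: "0 < b" and st: "s * t = 0"
    and u_mult: "\<And>g h. \<lbrakk>g \<in> carrier G; h \<in> carrier G\<rbrakk> \<Longrightarrow> [u (g \<otimes> h) = u g + u h] (mod int p ^ a)"
    and v_mult: "\<And>g h. \<lbrakk>g \<in> carrier G; h \<in> carrier G\<rbrakk> \<Longrightarrow> [v (g \<otimes> h) = v g + v h] (mod int p ^ b)"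
    and u_x: "[u x = 1] (mod int p ^ a)" and v_x: "[v x = s] (mod int p ^ b)"
    and u_y: "[u y = t] (mod int p ^ a)" and v_y: "[v y = 1] (mod int p ^ b)"
    and kernel: "\<And>i j. \<lbrakk>[i + t * j = 0] (mod int p ^ a); [s * i + j = 0] (mod int p ^ b)\<rbrakk> \<Longrightarrow>
      \<exists>j'. j = int p ^ \<beta> * j' \<and> [i + int p ^ \<kappa> * j' = 0] (mod int p ^ n)"
begin

lemma u_normal_form: "[u (y [^] j \<otimes> x [^] i) = i + t * j] (mod int p ^ a)"
  and v_normal_form: "[v (y [^] j \<otimes> x [^] i) = s * i + j] (mod int p ^ b)" for i j :: int
proof -
  have "[u (y [^] j \<otimes> x [^] i) = u (y [^] j) + u (x [^] i)] (mod int p ^ a)" by (rule u_mult) auto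
  also have "[u (y [^] j) + u (x [^] i) = j * u y + i * u x] (mod int p ^ a)"
    by (intro cong_add cong_additive_int_pow u_mult) auto
  also have "[j * u y + i * u x = j * t + i * 1] (mod int p ^ a)"
    by (intro cong_add cong_mult cong_refl u_x u_y)
  finally show "[u (y [^] j \<otimes> x [^] i) = i + t * j] (mod int p ^ a)" by (simp add: algebra_simps)
  have "[v (y [^] j \<otimes> x [^] i) = v (y [^] j) + v (x [^] i)] (mod int p ^ b)" by (rule v_mult) auto
  also have "[v (y [^] j) + v (x [^] i) = j * v y + i * v x] (mod int p ^ b)"
    by (intro cong_add cong_additive_int_pow v_mult) auto
  also have "[j * v y + i * v x = j * 1 + i * s] (mod int p ^ b)"
    by (intro cong_add cong_mult cong_refl v_x v_y)
  finally show "[v (y [^] j \<otimes> x [^] i) = s * i + j] (mod int p ^ b)" by (simp add: algebra_simps)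
qed

lemma u_el: "[u (el j i) = i + t * int j] (mod int p ^ a)"
  and v_el: "[v (el j i) = s * i + int j] (mod int p ^ b)"
  using u_normal_form[of "int j" i] v_normal_form[of "int j" i] by (simp_all add: el_def int_pow_int)

text \<open>
  Defined through the coordinates, hence independent of the chosen normal form; \<open>primitive_el\<close> gives the
  description by exponents.
\<close>

definition primitive :: "'a \<Rightarrow> bool" where
  "primitive g \<longleftrightarrow> (u g, v g) \<in> primitive_pairs p"

lemma p_dvd_cong:
  "[c = d] (mod int p ^ a) \<Longrightarrow> int p dvd c \<longleftrightarrow> int p dvd d"
  "[c = d] (mod int p ^ b) \<Longrightarrow> int p dvd c \<longleftrightarrow> int p dvd d"
proof -
  have "int p dvd int p ^ a" "int p dvd int p ^ b" using a_pos b_pos by (simp_all add: dvd_power)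
  then show "[c = d] (mod int p ^ a) \<Longrightarrow> int p dvd c \<longleftrightarrow> int p dvd d"
    "[c = d] (mod int p ^ b) \<Longrightarrow> int p dvd c \<longleftrightarrow> int p dvd d"
    using cong_dvd_iff cong_dvd_modulus by blast+
qed

lemma primitive_el: "primitive (el j i) \<longleftrightarrow> \<not> (p dvd j \<and> int p dvd i)"
proof -
  have "int p dvd i + t * int j \<and> int p dvd s * i + int j \<longleftrightarrow> int p dvd int j \<and> int p dvd i"
    using st by (auto simp: dvd_add_left_iff dvd_add_right_iff)
  then show ?thesis
    using p_dvd_cong(1)[OF u_el] p_dvd_cong(2)[OF v_el]
    by (simp add: primitive_def primitive_pairs_def) blast
qed

lemma primitive_int_pow:
  assumes g: "g \<in> carrier G" and "primitive (g [^] (k::int))"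
  shows "\<not> int p dvd k"
proof
  assume "int p dvd k"
  then have "int p dvd k * u g" "int p dvd k * v g" by auto
  then show False
    using assms(2) p_dvd_cong(1)[OF cong_additive_int_pow[OF u_mult g]]
      p_dvd_cong(2)[OF cong_additive_int_pow[OF v_mult g]]
    by (simp add: primitive_def primitive_pairs_def)
qed

lemma conjugate_if_same_coords:
  assumes g: "g \<in> carrier G" and h: "h \<in> carrier G" and prim: "primitive g"
    and eq: "[u g = u h] (mod int p ^ a)" "[v g = v h] (mod int p ^ b)"
  shows "\<exists>z\<in>carrier G. h = inv z \<otimes> g \<otimes> z"
proof -
  obtain j i where gi: "g = el j i" using g by (rule obtain_el)
  obtain j' i' where hi: "h = el j' i'" using h by (rule obtain_el)
  have "[i' + t * int j' = i + t * int j] (mod int p ^ a)"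
    using eq(1) u_el[of j i] u_el[of j' i'] unfolding gi hi by (meson cong_sym cong_trans)
  then have "[(i' - i) + t * (int j' - int j) = 0] (mod int p ^ a)"
    by (simp add: cong_iff_dvd_diff algebra_simps)
  moreover have "[s * i' + int j' = s * i + int j] (mod int p ^ b)"
    using eq(2) v_el[of j i] v_el[of j' i'] unfolding gi hi by (meson cong_sym cong_trans)
  then have "[s * (i' - i) + (int j' - int j) = 0] (mod int p ^ b)"
    by (simp add: cong_iff_dvd_diff algebra_simps)
  ultimately obtain m where m: "int j' - int j = int p ^ \<beta> * m"
      "[(i' - i) + int p ^ \<kappa> * m = 0] (mod int p ^ n)"
    using kernel by blast
  have y_pow: "y [^] (int p ^ \<beta> * m) = x [^] (int p ^ \<kappa> * m)"
  proof -
    have "y [^] (int p ^ \<beta>) = x [^] (int p ^ \<kappa>)"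
      using y_power int_pow_int[of G y "p ^ \<beta>"] int_pow_int[of G x "p ^ \<kappa>"] by simp
    then show ?thesis by (simp flip: int_pow_pow)
  qed
  have "int j' = int j + int p ^ \<beta> * m" using m(1) by simp
  then have "y [^] int j' = y [^] int j \<otimes> y [^] (int p ^ \<beta> * m)"
    by (simp only: int_pow_mult y)
  then have "h = el j (i' + int p ^ \<kappa> * m)"
    by (simp add: hi el_def y_pow int_pow_int m_assoc add.commute flip: int_pow_mult)
  moreover have "[i' + int p ^ \<kappa> * m = i] (mod int p ^ n)"
    using m(2) by (simp add: cong_iff_dvd_diff algebra_simps)
  ultimately show ?thesis
    using el_conjugate[of j i] prim unfolding gi primitive_el by blast
qed

text \<open>
  A generator of a maximal cyclic subgroup is primitive, since otherwise it is a \<open>p\<close>-th power \<open>h ^ p\<close>, and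
  \<open>\<langle>h ^ p\<rangle> = \<langle>h\<rangle>\<close> only if \<open>h\<close> is trivial; the trivial subgroup is not maximal, as it lies below
  \<open>\<langle>x\<rangle>\<close>. Conversely, if a primitive \<open>g\<close> is \<open>h ^ k\<close>, then \<open>p\<close> does not divide \<open>k\<close>, so \<open>h\<close>, having
  order a power of \<open>p\<close>, is a power of \<open>g\<close>.
\<close>

lemma maximal_cyclic_subgroup_iff:
  "maximal_cyclic_subgroup G C \<longleftrightarrow> (\<exists>g\<in>carrier G. primitive g \<and> C = powers g)"
proof
  assume max: "maximal_cyclic_subgroup G C"
  then obtain g where g: "g \<in> carrier G" "C = powers g"
    by (auto simp: maximal_cyclic_subgroup_def cyclic_subgroup_iff_powers)
  have not_less: "C = powers h" if "h \<in> carrier G" "C \<subseteq> powers h" for h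
    using max that by (auto simp: maximal_cyclic_subgroup_def cyclic_subgroup_iff_powers)
  have "primitive g"
  proof (rule ccontr)
    assume np: "\<not> primitive g"
    obtain j i where "g = el j i" using g(1) by (rule obtain_el)
    with np obtain j' i' where "g = el (p * j') (int p * i')"
      by (auto simp: primitive_el elim!: dvdE)
    then obtain h where h: "h \<in> carrier G" "g = h [^] p"
      using el_multiple_is_power by metis
    then have gh: "g = h [^] int p" by (simp add: int_pow_int)
    have "C = powers h"
      using not_less[OF h(1)] powers_mono_power[OF h(1)] gh g(2) by metis
    then obtain k where "h = g [^] (k::int)"
      using mem_powers[OF h(1)] g(2) by auto
    then have "h [^] (1 - int p * k) = \<one>"
      using h(1) by (simp add: int_pow_diff gh int_pow_pow)
    moreover have "\<not> int p dvd 1 - int p * k"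
      using prime_gt_1_nat[OF p] by (simp add: dvd_diff_left_iff)
    ultimately have "powers h = powers \<one>"
      using powers_unit_power[OF h(1) p torsion[OF h(1)]] by metis
    then have "C = {\<one>}" using \<open>C = powers h\<close> by auto
    then have "C = powers x" by (intro not_less) (auto intro: range_eqI[of _ _ 0])
    then have "x = \<one>" using mem_powers[OF x] \<open>C = {\<one>}\<close> by auto
    moreover have "primitive x" using primitive_el[of 0 1] prime_gt_1_nat[OF p] by (simp add: el_def)
    ultimately show False using primitive_int_pow[of x 0] by simp
  qed
  with g show "\<exists>g\<in>carrier G. primitive g \<and> C = powers g" by blast
next
  assume "\<exists>g\<in>carrier G. primitive g \<and> C = powers g"
  then obtain g where g: "g \<in> carrier G" "primitive g" "C = powers g" by blast
  have "D = C" if D: "cyclic_subgroup G D" "C \<subseteq> D" for D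
  proof -
    obtain h where h: "h \<in> carrier G" "D = powers h"
      using D(1) by (auto simp: cyclic_subgroup_iff_powers)
    obtain k where k: "g = h [^] (k::int)"
      using mem_powers[OF g(1)] D(2) g(3) h(2) by auto
    then have "\<not> int p dvd k" using primitive_int_pow[OF h(1)] g(2) by simp
    then show ?thesis
      using powers_unit_power[OF h(1) p torsion[OF h(1)]] k g(3) h(2) by simp
  qed
  then show "maximal_cyclic_subgroup G C"
    using g by (auto simp: maximal_cyclic_subgroup_def cyclic_subgroup_iff_powers)
qed

text \<open>
  The coordinates are invariant under conjugation, and another generator of \<open>\<langle>g\<rangle>\<close> multiplies them by a
  unit. For the converse, \<open>h\<close> and \<open>g ^ k\<close> with equal coordinates are conjugate because they are primitive
  elements of one coset of the commutator subgroup.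
\<close>

lemma conjugate_powers_iff:
  assumes g: "g \<in> carrier G" "primitive g" and h: "h \<in> carrier G" "primitive h"
  shows "(powers g, powers h) \<in> conjugacy_rel G \<longleftrightarrow> unit_multiple p a b (u g, v g) (u h, v h)"
proof
  assume "(powers g, powers h) \<in> conjugacy_rel G"
  then obtain z where z: "z \<in> carrier G" "powers h = powers (inv z \<otimes> g \<otimes> z)"
    using conjugacy_rel_powers g(1) by blast
  interpret c: group_hom G G "\<lambda>g. inv z \<otimes> g \<otimes> z" by (rule conjugation_hom[OF z(1)])
  have "h \<in> powers (inv z \<otimes> g \<otimes> z)" using mem_powers[OF h(1)] z(2) by simp
  then obtain k where "h = (inv z \<otimes> g \<otimes> z) [^] (k::int)" by auto
  then have hk: "z \<otimes> h = g [^] k \<otimes> z"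
    using c.hom_int_pow[OF g(1)] z(1) g(1) by (simp add: m_assoc inv_solve_left')
  have coords: "[k * f g = f h] (mod m)"
    if f: "\<And>g h. \<lbrakk>g \<in> carrier G; h \<in> carrier G\<rbrakk> \<Longrightarrow> [f (g \<otimes> h) = f g + f h] (mod m)"
    for f and m :: int
  proof -
    have "[f (z \<otimes> h) = f z + f h] (mod m)" by (rule f[OF z(1) h(1)])
    moreover have "[f (g [^] k \<otimes> z) = f (g [^] k) + f z] (mod m)" using g(1) z(1) by (intro f) auto
    ultimately have "[f z + f h = f (g [^] k) + f z] (mod m)"
      unfolding hk by (meson cong_sym cong_trans)
    then have "[f h = f (g [^] k)] (mod m)" by (simp add: add.commute[of _ "f z"] cong_add_lcancel)
    then show ?thesis using cong_additive_int_pow[OF f g(1)] by (meson cong_sym cong_trans)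
  qed
  have cu: "[k * u g = u h] (mod int p ^ a)" by (rule coords) (rule u_mult)
  have cv: "[k * v g = v h] (mod int p ^ b)" by (rule coords) (rule v_mult)
  have "\<not> int p dvd k"
    using h(2) p_dvd_cong(1)[OF cu] p_dvd_cong(2)[OF cv] by (auto simp: primitive_def primitive_pairs_def)
  with cu cv show "unit_multiple p a b (u g, v g) (u h, v h)" by (auto simp: unit_multiple_def)
next
  assume "unit_multiple p a b (u g, v g) (u h, v h)"
  then obtain k where k: "\<not> int p dvd k" "[k * u g = u h] (mod int p ^ a)" "[k * v g = v h] (mod int p ^ b)"
    by (auto simp: unit_multiple_def)
  have cu: "[u h = u (g [^] k)] (mod int p ^ a)"
    using k(2) cong_additive_int_pow[OF u_mult g(1), of k] by (meson cong_sym cong_trans)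
  have cv: "[v h = v (g [^] k)] (mod int p ^ b)"
    using k(3) cong_additive_int_pow[OF v_mult g(1), of k] by (meson cong_sym cong_trans)
  have gk: "g [^] k \<in> carrier G" using g(1) by simp
  have "primitive (g [^] k)"
    using h(2) p_dvd_cong(1)[OF cu] p_dvd_cong(2)[OF cv] by (simp add: primitive_def primitive_pairs_def)
  then obtain z where "z \<in> carrier G" "h = inv z \<otimes> g [^] k \<otimes> z"
    using conjugate_if_same_coords[OF gk h(1)] cu cv cong_sym by blast
  then have "(powers (g [^] k), powers h) \<in> conjugacy_rel G"
    using conjugacy_rel_powers[OF gk] by blast
  then show "(powers g, powers h) \<in> conjugacy_rel G"
    using powers_unit_power[OF g(1) p torsion[OF g(1)] k(1)] by simp
qed

theorem eta_eq_g_fun: "eta G = g_fun p a b"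
proof -
  obtain T where T: "T \<subseteq> primitive_pairs p" "card T = g_fun p a b"
      "\<And>q. q \<in> primitive_pairs p \<Longrightarrow> \<exists>\<tau>\<in>T. unit_multiple p a b \<tau> q"
      "\<And>\<tau> \<tau>'. \<lbrakk>\<tau> \<in> T; \<tau>' \<in> T; unit_multiple p a b \<tau> \<tau>'\<rbrakk> \<Longrightarrow> \<tau> = \<tau>'"
    using primitive_pairs_transversal[OF p a_pos b_pos] by metis
  \<comment> \<open>The inverse of the change of basis: \<open>e \<tau>\<close> is an element with the coordinates \<open>\<tau>\<close>.\<close>
  define e where "e \<tau> = y [^] (snd \<tau> - s * fst \<tau>) \<otimes> x [^] (fst \<tau> - t * snd \<tau>)" for \<tau>
  have e: "e \<tau> \<in> carrier G" "[fst \<tau> = u (e \<tau>)] (mod int p ^ a)" "[snd \<tau> = v (e \<tau>)] (mod int p ^ b)" for \<tau>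
  proof -
    show "e \<tau> \<in> carrier G" by (simp add: e_def)
    have ts: "t * (s * z) = 0" "s * (t * z) = 0" for z using st by auto
    show "[fst \<tau> = u (e \<tau>)] (mod int p ^ a)"
      using u_normal_form[of "snd \<tau> - s * fst \<tau>" "fst \<tau> - t * snd \<tau>"]
      by (simp add: e_def algebra_simps ts cong_sym_eq)
    show "[snd \<tau> = v (e \<tau>)] (mod int p ^ b)"
      using v_normal_form[of "snd \<tau> - s * fst \<tau>" "fst \<tau> - t * snd \<tau>"]
      by (simp add: e_def algebra_simps ts cong_sym_eq)
  qed
  have um: "unit_multiple p a b \<tau> (u (e \<tau>), v (e \<tau>))" for \<tau>
    unfolding unit_multiple_def using e prime_gt_1_nat[OF p] by (intro exI[of _ 1]) auto
  have prim: "primitive (e \<tau>)" if "\<tau> \<in> T" for \<tau>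
  proof -
    have "\<not> (int p dvd fst \<tau> \<and> int p dvd snd \<tau>)"
      using that T(1) by (auto simp: primitive_pairs_def)
    then show ?thesis
      using p_dvd_cong(1)[OF e(2)[of \<tau>]] p_dvd_cong(2)[OF e(3)[of \<tau>]]
      by (simp add: primitive_def primitive_pairs_def)
  qed
  have inj: "inj_on (\<lambda>\<tau>. conjugacy_rel G `` {powers (e \<tau>)}) T"
  proof (rule inj_onI)
    fix \<tau> \<tau>' assume \<tau>: "\<tau> \<in> T" "\<tau>' \<in> T"
      "conjugacy_rel G `` {powers (e \<tau>)} = conjugacy_rel G `` {powers (e \<tau>')}"
    have "unit_multiple p a b (u (e \<tau>), v (e \<tau>)) (u (e \<tau>'), v (e \<tau>'))"
      using \<tau>(3) unfolding conjugacy_class_eq_iff[OF e(1) e(1)]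
        conjugate_powers_iff[OF e(1) prim[OF \<tau>(1)] e(1) prim[OF \<tau>(2)]] .
    then have "unit_multiple p a b \<tau> \<tau>'"
      by (rule unit_multiple_trans[OF p unit_multiple_trans[OF p um] unit_multiple_sym[OF p um]])
    then show "\<tau> = \<tau>'" by (rule T(4)[OF \<tau>(1,2)])
  qed
  have surj: "(\<lambda>\<tau>. conjugacy_rel G `` {powers (e \<tau>)}) ` T = {C. maximal_cyclic_subgroup G C} // conjugacy_rel G"
  proof (intro equalityI subsetI)
    fix Q assume "Q \<in> (\<lambda>\<tau>. conjugacy_rel G `` {powers (e \<tau>)}) ` T"
    then obtain \<tau> where \<tau>: "\<tau> \<in> T" "Q = conjugacy_rel G `` {powers (e \<tau>)}" by auto
    have "maximal_cyclic_subgroup G (powers (e \<tau>))"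
      unfolding maximal_cyclic_subgroup_iff by (rule bexI[of _ "e \<tau>"]) (simp_all add: prim[OF \<tau>(1)] e(1))
    then show "Q \<in> {C. maximal_cyclic_subgroup G C} // conjugacy_rel G"
      unfolding \<tau>(2) by (intro quotientI) simp
  next
    fix Q assume "Q \<in> {C. maximal_cyclic_subgroup G C} // conjugacy_rel G"
    then obtain g where g: "g \<in> carrier G" "primitive g" "Q = conjugacy_rel G `` {powers g}"
      using maximal_cyclic_subgroup_iff by (auto elim!: quotientE)
    obtain \<tau> where \<tau>: "\<tau> \<in> T" "unit_multiple p a b \<tau> (u g, v g)"
      using T(3)[OF g(2)[unfolded primitive_def]] by blast
    have "unit_multiple p a b (u (e \<tau>), v (e \<tau>)) (u g, v g)"
      by (rule unit_multiple_trans[OF p unit_multiple_sym[OF p um] \<tau>(2)])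
    then have "conjugacy_rel G `` {powers (e \<tau>)} = Q"
      unfolding g(3) conjugacy_class_eq_iff[OF e(1) g(1)]
        conjugate_powers_iff[OF e(1) prim[OF \<tau>(1)] g(1,2)] .
    then show "Q \<in> (\<lambda>\<tau>. conjugacy_rel G `` {powers (e \<tau>)}) ` T"
      using \<tau>(1) by (intro image_eqI[of _ _ \<tau>]) simp_all
  qed
  show ?thesis
    using card_image[OF inj] T(2) by (simp add: eta_def surj)
qed

end

section \<open>From the presentation to normal forms and coordinates\<close>

fun letter_weight :: "('g \<Rightarrow> int) \<Rightarrow> 'g letter \<Rightarrow> int" where
  "letter_weight c (Pos g) = c g"
| "letter_weight c (Neg g) = - c g"

text \<open>
  The homomorphism from the free group to the integers that sends each generator \<open>g\<close> to \<open>c g\<close>.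
\<close>

definition weight :: "('g \<Rightarrow> int) \<Rightarrow> 'g word \<Rightarrow> int" where
  "weight c w = sum_list (map (letter_weight c) w)"

lemma weight_append: "weight c (w @ w') = weight c w + weight c w'"
  by (simp add: weight_def)

lemma weight_Nil: "weight c [] = 0"
  by (simp add: weight_def)

lemma weight_replicate_Pos: "weight c (replicate k (Pos g)) = int k * c g"
  by (simp add: weight_def sum_list_replicate)

lemma weight_cong:
  assumes R: "\<And>w w'. (w, w') \<in> R \<Longrightarrow> [weight c w = weight c w'] (mod m)"
    and "word_eq R w w'"
  shows "[weight c w = weight c w'] (mod m)"
  using assms(2)
proof (induction rule: word_eq.induct)
  case (sym w w')
  then show ?case by (blast intro: cong_sym)
next
  case (trans w w' w'')
  then show ?case by (blast intro: cong_trans)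
next
  case (append w w' z z')
  then show ?case by (simp add: weight_append cong_add)
next
  case (relation w w')
  then show ?case by (rule R)
qed (simp_all add: weight_def)

text \<open>
  An isomorphism with a presented group amounts to an evaluation of words whose kernel is the
  congruence \<open>word_eq\<close>.
\<close>

lemma evaluation_of_words:
  assumes G: "group G" and iso: "G \<cong> presented_group R"
  obtains ev where "range ev = carrier G" "ev [] = \<one>\<^bsub>G\<^esub>" "\<And>w w'. ev (w @ w') = ev w \<otimes>\<^bsub>G\<^esub> ev w'"
    "\<And>w w'. ev w = ev w' \<longleftrightarrow> word_eq R w w'"
proof -
  obtain h where h: "h \<in> iso (presented_group R) G"
    using group.iso_sym[OF G iso] by (auto simp: is_iso_def)
  interpret group_hom "presented_group R" G h
    using h G group_presented_group by (auto simp: group_hom_def group_hom_axioms_def iso_def)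
  have bij: "bij_betw h (range (word_class R)) (carrier G)"
    using h by (simp add: iso_def carrier_presented_group)
  show thesis
  proof (rule that[of "\<lambda>w. h (word_class R w)"])
    show "range (\<lambda>w. h (word_class R w)) = carrier G"
      using bij by (simp add: bij_betw_def image_image)
    show "h (word_class R []) = \<one>\<^bsub>G\<^esub>" using hom_one by (simp add: one_presented_group)
    show "h (word_class R (w @ w')) = h (word_class R w) \<otimes>\<^bsub>G\<^esub> h (word_class R w')" for w w'
      using hom_mult[of "word_class R w" "word_class R w'"]
      by (simp add: carrier_presented_group presented_group_mult)
    show "h (word_class R w) = h (word_class R w') \<longleftrightarrow> word_eq R w w'" for w w'
      using bij by (auto simp: bij_betw_def inj_on_def simp flip: word_class_eq_iff)
  qed
qed

text \<open>
  The hypotheses \<open>rel_a\<close> and \<open>rel_b\<close> say that the assignment \<open>x \<mapsto> (1, s)\<close>, \<open>y \<mapsto> (t, 1)\<close> respects the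
  defining relations modulo \<open>p ^ a\<close> and \<open>p ^ b\<close>; the two coordinates of a group element are then the
  weights of any word representing it.
\<close>

proposition eta_metacyclic_positive:
  fixes G :: "('a, 'b) monoid_scheme" and s t :: int
  assumes p: "prime p" and params: "positive_type_params p \<alpha> \<beta> \<epsilon> \<delta>"
    and G: "group G" and iso: "G \<cong> metacyclic_positive p \<alpha> \<beta> \<epsilon> \<delta>"
    and ab: "0 < a" "0 < b" and st: "s * t = 0"
    and rel_a: "a \<le> \<alpha> - \<delta>" "[int p ^ \<beta> * t = int p ^ (\<alpha> - \<epsilon>)] (mod int p ^ a)"
    and rel_b: "[int p ^ (\<alpha> - \<delta>) * s = 0] (mod int p ^ b)" "[int p ^ \<beta> = int p ^ (\<alpha> - \<epsilon>) * s] (mod int p ^ b)"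
    and kernel: "\<And>i j. \<lbrakk>[i + t * j = 0] (mod int p ^ a); [s * i + j = 0] (mod int p ^ b)\<rbrakk> \<Longrightarrow>
      \<exists>j'. j = int p ^ \<beta> * j' \<and> [i + int p ^ (\<alpha> - \<epsilon>) * j' = 0] (mod int p ^ (\<alpha> - \<delta>))"
  shows "eta G = g_fun p a b"
proof -
  interpret group G by (rule G)
  define R where "R = {(replicate (p ^ \<alpha>) (Pos gen_x), []),
      (replicate (p ^ \<beta>) (Pos gen_y), replicate (p ^ (\<alpha> - \<epsilon>)) (Pos gen_x)),
      ([Neg gen_y, Pos gen_x, Pos gen_y], replicate (p ^ (\<alpha> - \<delta>) + 1) (Pos gen_x))}"
  obtain ev where ev: "range ev = carrier G" "ev [] = \<one>\<^bsub>G\<^esub>" "\<And>w w'. ev (w @ w') = ev w \<otimes>\<^bsub>G\<^esub> ev w'"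
    "\<And>w w'. ev w = ev w' \<longleftrightarrow> word_eq R w w'"
    using evaluation_of_words[OF G iso[unfolded metacyclic_positive_def, folded R_def]] by metis
  define x y where "x = ev [Pos gen_x]" and "y = ev [Pos gen_y]"
  have ev_closed [simp]: "ev w \<in> carrier G" for w using ev(1) by blast
  have ev_Cons: "ev (l # w) = ev [l] \<otimes>\<^bsub>G\<^esub> ev w" for l w using ev(3)[of "[l]" w] by simp
  have xy [simp]: "x \<in> carrier G" "y \<in> carrier G" by (auto simp: x_def y_def)
  have ev_rep: "ev (replicate k (Pos g)) = ev [Pos g] [^]\<^bsub>G\<^esub> k" for k g
  proof (induction k)
    case (Suc k)
    then show ?case by (metis ev_Cons ev_closed nat_pow_Suc2 replicate_Suc)
  qed (simp add: ev)
  have ev_Neg: "ev [Neg g] = inv\<^bsub>G\<^esub> (ev [Pos g])" for g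
  proof -
    have "ev [Neg g, Pos g] = \<one>\<^bsub>G\<^esub>"
      unfolding ev(2)[symmetric] ev(4) by (rule word_eq.inv_left)
    then show ?thesis using ev_Cons[of "Neg g" "[Pos g]"] by (simp add: inv_equality)
  qed
  have rel: "ev w = ev w'" if "(w, w') \<in> R" for w w'
    using that ev(4) by (blast intro: word_eq.relation)
  have conj: "inv\<^bsub>G\<^esub> y \<otimes>\<^bsub>G\<^esub> x \<otimes>\<^bsub>G\<^esub> y = x [^]\<^bsub>G\<^esub> (p ^ (\<alpha> - \<delta>) + 1)"
  proof -
    have "ev [Neg gen_y, Pos gen_x, Pos gen_y] = ev (replicate (p ^ (\<alpha> - \<delta>) + 1) (Pos gen_x))"
      by (rule rel) (simp add: R_def)
    moreover have "ev [Neg gen_y, Pos gen_x, Pos gen_y] = inv\<^bsub>G\<^esub> y \<otimes>\<^bsub>G\<^esub> x \<otimes>\<^bsub>G\<^esub> y"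
      unfolding ev_Cons[of "Neg gen_y"] ev_Cons[of "Pos gen_x" "[Pos gen_y]"] ev_Neg
      by (simp add: m_assoc x_def y_def)
    ultimately show ?thesis by (simp only: ev_rep x_def)
  qed
  have pm: "0 < \<alpha> - \<delta>" "p = 2 \<longrightarrow> 1 < \<alpha> - \<delta>" "\<alpha> - \<delta> \<le> \<alpha>"
    using params by (auto simp: positive_type_params_def)
  have x_pow: "x [^]\<^bsub>G\<^esub> (p ^ \<alpha>) = \<one>\<^bsub>G\<^esub>"
    using rel[of "replicate (p ^ \<alpha>) (Pos gen_x)" "[]"] by (simp add: R_def ev_rep ev(2) x_def)
  have y_pow: "y [^]\<^bsub>G\<^esub> (p ^ \<beta>) = x [^]\<^bsub>G\<^esub> (p ^ (\<alpha> - \<epsilon>))"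
    using rel[of "replicate (p ^ \<beta>) (Pos gen_y)" "replicate (p ^ (\<alpha> - \<epsilon>)) (Pos gen_x)"]
    by (simp add: R_def ev_rep x_def y_def)
  interpret rels: metacyclic_relations G x y p \<alpha> \<beta> "\<alpha> - \<epsilon>" "\<alpha> - \<delta>"
    by unfold_locales (use p x_pow y_pow conj pm in auto)
  have normal_form: "ev w \<in> range (case_prod rels.el)" for w
  proof (induction w rule: rev_induct)
    case Nil
    then show ?case by (auto simp: ev(2) rels.el_def intro!: range_eqI[of _ _ "(0, 0)"])
  next
    case (snoc l w)
    have "ev [l] \<in> {x, inv\<^bsub>G\<^esub> x, y, inv\<^bsub>G\<^esub> y}"
    proof (cases l)
      case (Pos g)
      then show ?thesis by (cases g) (auto simp: x_def y_def)
    next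
      case (Neg g)
      then show ?thesis by (cases g) (auto simp: x_def y_def ev_Neg)
    qed
    then show ?case using rels.normal_form_mult[OF snoc] by (simp add: ev(3))
  qed
  define word where "word g = inv_into UNIV ev g" for g
  have word: "ev (word g) = g" if "g \<in> carrier G" for g
    using that ev(1) by (simp add: word_def f_inv_into_f)
  define cu where "cu = case_metacyclic_gen 1 t"
  define cv where "cv = case_metacyclic_gen s 1"
  have weight_conj: "weight c [Neg gen_y, Pos gen_x, Pos gen_y] = c gen_x" for c
    by (simp add: weight_def)
  have cu_R: "[weight cu w = weight cu w'] (mod int p ^ a)" if "(w, w') \<in> R" for w w'
  proof -
    have "int p ^ a dvd int p ^ \<alpha>" "int p ^ a dvd int p ^ (\<alpha> - \<delta>)"
      using rel_a(1) pm(3) by (simp_all add: le_imp_power_dvd)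
    then show ?thesis
      using that rel_a(2) unfolding R_def
      by (auto simp: weight_conj weight_replicate_Pos weight_Nil cu_def cong_iff_dvd_diff
            simp del: replicate_Suc)
  qed
  have cv_R: "[weight cv w = weight cv w'] (mod int p ^ b)" if "(w, w') \<in> R" for w w'
  proof -
    have "int p ^ b dvd int p ^ (\<alpha> - \<delta>) * s" using rel_b(1) by (simp add: cong_0_iff)
    moreover from this have "int p ^ b dvd int p ^ \<alpha> * s"
      by (rule dvd_trans) (simp add: le_imp_power_dvd mult_dvd_mono)
    ultimately show ?thesis
      using that rel_b(2) unfolding R_def
      by (auto simp: weight_conj weight_replicate_Pos weight_Nil cv_def cong_iff_dvd_diff algebra_simps
            simp del: replicate_Suc)
  qed
  have additive: "[weight c (word (g \<otimes>\<^bsub>G\<^esub> h)) = weight c (word g) + weight c (word h)] (mod m)"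
    if "\<And>w w'. (w, w') \<in> R \<Longrightarrow> [weight c w = weight c w'] (mod m)" "g \<in> carrier G" "h \<in> carrier G"
    for c m g h
  proof -
    have "ev (word (g \<otimes>\<^bsub>G\<^esub> h)) = ev (word g @ word h)"
      using that by (simp add: word ev(3))
    then show ?thesis
      using weight_cong[OF that(1)] ev(4) by (simp flip: weight_append)
  qed
  have gens: "[weight c (word (ev [Pos g])) = c g] (mod m)"
    if "\<And>w w'. (w, w') \<in> R \<Longrightarrow> [weight c w = weight c w'] (mod m)" for c m g
  proof -
    have "ev (word (ev [Pos g])) = ev [Pos g]" by (rule word[OF ev_closed])
    then have "[weight c (word (ev [Pos g])) = weight c [Pos g]] (mod m)"
      using weight_cong[OF that] ev(4) by blast
    then show ?thesis by (simp add: weight_def)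
  qed
  interpret abelianized_metacyclic G x y p \<alpha> \<beta> "\<alpha> - \<epsilon>" "\<alpha> - \<delta>" "\<lambda>g. weight cu (word g)" "\<lambda>g. weight cv (word g)" a b s t
  proof unfold_locales
    show "carrier G = range (case_prod rels.el)"
      (is "_ = ?N")
    proof (rule equalityI)
      show "carrier G \<subseteq> ?N" unfolding ev(1)[symmetric] using normal_form by blast
    qed auto
  next
    show "[weight cu (word x) = 1] (mod int p ^ a)" "[weight cu (word y) = t] (mod int p ^ a)"
      using gens[OF cu_R, of gen_x] gens[OF cu_R, of gen_y] by (simp_all add: x_def y_def cu_def)
    show "[weight cv (word x) = s] (mod int p ^ b)" "[weight cv (word y) = 1] (mod int p ^ b)"
      using gens[OF cv_R, of gen_x] gens[OF cv_R, of gen_y] by (simp_all add: x_def y_def cv_def)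
  qed (use p x_pow y_pow conj pm ab st kernel additive[OF cu_R] additive[OF cv_R] in auto)
  show ?thesis by (rule eta_eq_g_fun)
qed

section \<open>The two types of abelianization\<close>

lemma int_g_fun:
  assumes "0 < p" "l \<le> k"
  shows "int (g_fun p k l) = int p ^ (l - 1) * ((int k - int l) * (int p - 1) + int p + 1)"
    and "g_fun p l k = g_fun p k l"
proof -
  have "g_fun p k l = p ^ (l - 1) * ((k - l) * (p - 1) + p + 1)"
    using assms(2) by (simp add: g_fun_def Let_def max_absorb1 min_absorb2)
  moreover have "int (p - 1) = int p - 1" "int (k - l) = int k - int l"
    using assms by (simp_all add: of_nat_diff)
  ultimately show "int (g_fun p k l) = int p ^ (l - 1) * ((int k - int l) * (int p - 1) + int p + 1)"
    by (simp only: of_nat_mult of_nat_add of_nat_power of_nat_1)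
  show "g_fun p l k = g_fun p k l"
    by (simp add: g_fun_def max.commute min.commute)
qed

theorem corollary3p6:
  fixes p \<alpha> \<beta> \<epsilon> \<delta> :: nat and G :: "('a, 'b) monoid_scheme"
  assumes "prime p"
    and "positive_type_params p \<alpha> \<beta> \<epsilon> \<delta>"
    and "group G"
    and "G \<cong> metacyclic_positive p \<alpha> \<beta> \<epsilon> \<delta>"
  shows "(\<delta> \<ge> \<epsilon> \<or> (\<delta> < \<epsilon> \<and> \<alpha> \<ge> \<beta> + \<epsilon>) \<longrightarrow>
            eta G = g_fun p (\<alpha> - \<delta>) \<beta> \<and>
            (\<beta> \<le> \<alpha> - \<delta> \<longrightarrow>
               int (eta G) = int p ^ (\<beta> - 1) *
                 ((int \<alpha> - int \<delta> - int \<beta>) * (int p - 1) + int p + 1)) \<and>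
            (\<beta> > \<alpha> - \<delta> \<longrightarrow>
               int (eta G) = int p ^ (\<alpha> - \<delta> - 1) *
                 ((int \<beta> - int \<alpha> + int \<delta>) * (int p - 1) + int p + 1))) \<and>
         (\<delta> < \<epsilon> \<and> \<alpha> < \<beta> + \<epsilon> \<and> \<alpha> - \<epsilon> > 0 \<longrightarrow>
            eta G = g_fun p (\<alpha> - \<epsilon>) (\<beta> + \<epsilon> - \<delta>) \<and>
            int (eta G) = int p ^ (\<alpha> - \<epsilon> - 1) *
              ((int \<beta> - int \<alpha> + 2 * int \<epsilon> - int \<delta>) * (int p - 1) + int p + 1))"
proof -
  note eta = eta_metacyclic_positive[OF assms]
  have p0: "0 < p" using assms(1) by (rule prime_gt_0_nat)
  have par: "0 < \<beta>" "\<delta> < \<alpha>" "\<delta> + \<epsilon> \<le> \<alpha>"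
    using assms(2) by (auto simp: positive_type_params_def)
  have first: "eta G = g_fun p (\<alpha> - \<delta>) \<beta>"
    if c: "\<delta> \<ge> \<epsilon> \<or> (\<delta> < \<epsilon> \<and> \<alpha> \<ge> \<beta> + \<epsilon>)"
  proof -
    \<comment> \<open>With this \<open>t\<close> the element \<open>y - t x\<close> has order \<open>p ^ \<beta>\<close> in the abelianization.\<close>
    define t where "t = (if \<delta> \<ge> \<epsilon> then 0 else int p ^ (\<alpha> - \<epsilon> - \<beta>))"
    have t: "[int p ^ \<beta> * t = int p ^ (\<alpha> - \<epsilon>)] (mod int p ^ (\<alpha> - \<delta>))"
    proof (cases "\<delta> \<ge> \<epsilon>")
      case True
      then show ?thesis by (simp add: t_def cong_iff_dvd_diff le_imp_power_dvd)
    next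
      case False
      with c have "\<beta> + (\<alpha> - \<epsilon> - \<beta>) = \<alpha> - \<epsilon>" by simp
      with False show ?thesis by (simp add: t_def flip: power_add)
    qed
    show ?thesis
    proof (rule eta[where s = 0 and t = t])
      fix i j :: int
      assume ij: "[i + t * j = 0] (mod int p ^ (\<alpha> - \<delta>))" "[0 * i + j = 0] (mod int p ^ \<beta>)"
      then obtain j' where j': "j = int p ^ \<beta> * j'" by (auto simp: cong_0_iff)
      have "[i + int p ^ \<beta> * t * j' = i + int p ^ (\<alpha> - \<epsilon>) * j'] (mod int p ^ (\<alpha> - \<delta>))"
        by (intro cong_add cong_refl cong_scalar_right t)
      moreover have "i + t * j = i + int p ^ \<beta> * t * j'" by (simp add: j')
      ultimately have "[i + int p ^ (\<alpha> - \<epsilon>) * j' = 0] (mod int p ^ (\<alpha> - \<delta>))"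
        using ij(1) by (metis cong_sym cong_trans)
      with j' show "\<exists>j'. j = int p ^ \<beta> * j' \<and> [i + int p ^ (\<alpha> - \<epsilon>) * j' = 0] (mod int p ^ (\<alpha> - \<delta>))"
        by blast
    qed (use par t in \<open>auto simp: cong_0_iff\<close>)
  qed
  have second: "eta G = g_fun p (\<alpha> - \<epsilon>) (\<beta> + \<epsilon> - \<delta>)"
    if c: "\<delta> < \<epsilon>" "\<alpha> < \<beta> + \<epsilon>" "\<alpha> - \<epsilon> > 0"
  proof (rule eta[where s = "int p ^ (\<beta> + \<epsilon> - \<alpha>)" and t = 0])
    \<comment> \<open>Here \<open>x - s y\<close> has order \<open>p ^ (\<alpha> - \<epsilon>)\<close> in the abelianization.\<close>
    have e: "\<alpha> - \<epsilon> + (\<beta> + \<epsilon> - \<alpha>) = \<beta>" "\<alpha> - \<delta> + (\<beta> + \<epsilon> - \<alpha>) = \<beta> + \<epsilon> - \<delta>"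
        "\<beta> + \<epsilon> - \<delta> = \<beta> + (\<epsilon> - \<delta>)" "\<alpha> - \<epsilon> + (\<epsilon> - \<delta>) = \<alpha> - \<delta>"
      using c par by auto
    show "[int p ^ (\<alpha> - \<delta>) * int p ^ (\<beta> + \<epsilon> - \<alpha>) = 0] (mod int p ^ (\<beta> + \<epsilon> - \<delta>))"
      by (simp add: e(2) cong_0_iff flip: power_add)
    show "[int p ^ \<beta> = int p ^ (\<alpha> - \<epsilon>) * int p ^ (\<beta> + \<epsilon> - \<alpha>)] (mod int p ^ (\<beta> + \<epsilon> - \<delta>))"
      by (simp add: e(1) flip: power_add)
    fix i j :: int
    assume "[i + 0 * j = 0] (mod int p ^ (\<alpha> - \<epsilon>))"
      and j: "[int p ^ (\<beta> + \<epsilon> - \<alpha>) * i + j = 0] (mod int p ^ (\<beta> + \<epsilon> - \<delta>))"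
    then obtain i' where i': "i = int p ^ (\<alpha> - \<epsilon>) * i'" by (auto simp: cong_0_iff)
    have "int p ^ (\<beta> + \<epsilon> - \<alpha>) * i = int p ^ \<beta> * i'"
      unfolding i' by (subst e(1)[symmetric]) (simp only: power_add mult_ac)
    then obtain d where "int p ^ \<beta> * i' + j = int p ^ (\<beta> + (\<epsilon> - \<delta>)) * d"
      using j by (auto simp: cong_0_iff e(3))
    then have "j = int p ^ \<beta> * (int p ^ (\<epsilon> - \<delta>) * d - i')"
      by (simp add: power_add algebra_simps)
    moreover have "i + int p ^ (\<alpha> - \<epsilon>) * (int p ^ (\<epsilon> - \<delta>) * d - i') = int p ^ (\<alpha> - \<delta>) * d"
      by (subst e(4)[symmetric]) (simp add: i' power_add algebra_simps)
    ultimately show "\<exists>j'. j = int p ^ \<beta> * j' \<and> [i + int p ^ (\<alpha> - \<epsilon>) * j' = 0] (mod int p ^ (\<alpha> - \<delta>))"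
      by (metis cong_0_iff dvd_triv_left)
  qed (use c par in \<open>auto simp: cong_iff_dvd_diff\<close>)
  have first_int: "int (g_fun p (\<alpha> - \<delta>) \<beta>) = int p ^ (\<beta> - 1) *
      ((int \<alpha> - int \<delta> - int \<beta>) * (int p - 1) + int p + 1)" if "\<beta> \<le> \<alpha> - \<delta>"
    using int_g_fun(1)[OF p0 that] par by (simp add: of_nat_diff)
  have first_int': "int (g_fun p (\<alpha> - \<delta>) \<beta>) = int p ^ (\<alpha> - \<delta> - 1) *
      ((int \<beta> - int \<alpha> + int \<delta>) * (int p - 1) + int p + 1)" if "\<beta> > \<alpha> - \<delta>"
    using int_g_fun[OF p0, of "\<alpha> - \<delta>" \<beta>] that par by (simp add: of_nat_diff algebra_simps)
  have second_int: "int (g_fun p (\<alpha> - \<epsilon>) (\<beta> + \<epsilon> - \<delta>)) = int p ^ (\<alpha> - \<epsilon> - 1) *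
      ((int \<beta> - int \<alpha> + 2 * int \<epsilon> - int \<delta>) * (int p - 1) + int p + 1)"
    if "\<delta> < \<epsilon>" "\<alpha> < \<beta> + \<epsilon>"
    using int_g_fun[OF p0, of "\<alpha> - \<epsilon>" "\<beta> + \<epsilon> - \<delta>"] that par
    by (simp add: of_nat_diff algebra_simps)
  show ?thesis
    using first second first_int first_int' second_int by auto
qed

end
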